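(* Let $(X,d)$ be a compact metric space, $f_{0,\infty}=\{f_n\}_{n=0}^\infty$ a sequence of continuous self-maps of $X$, and $A\in\mathcal{S}$. Then $h_A(f_{0,\infty})>0$ if and only if $h_A(\hat{f}_{0,\infty})=+\infty$. Consequently, $h^{*}(f_{0,\infty})>0$ if and only if $h^{*}(\hat{f}_{0,\infty})=+\infty$.
   Context: $f_0^n=f_{n-1}\circ\cdots\circ f_0$, $f_0^0=\mathrm{id}$. $\mathcal S$ is the set of strictly increasing sequences $A=\{a_i\}_{i\ge1}$ of nonnegative integers. For a compact metric space $Z$ and continuous self-maps $g_{0,\infty}$ of $Z$, $h_A(g_{0,\infty})=\sup_{\mathscr A}\limsup_{n\to\infty}\frac1n\log\mathcal N(\bigvee_{i=1}^n (g_0^{a_i})^{-1}\mathscr A)$ over finite open covers $\mathscr A$ of $Z$ ($\bigvee$ = common refinement, $\mathcal N$ = minimal cardinality of a subcover), and $h^*(g_{0,\infty})=\sup_{A\in\mathcal S}h_A(g_{0,\infty})$. $\mathcal M(X)$ is the space of Borel probability measures on $X$ with the weak$^*$ topology (compact metric, e.g. via the Prohorov metric), and $\hat f_{0,\infty}=\{\hat f_n\}$ with $\hat f_n(\mu)(B)=\mu(f_n^{-1}(B))$ for Borel $B$. *)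

theory Defs
  imports "HOL-Probability.Probability"
begin

primrec comp_seq :: "(nat \<Rightarrow> 'b \<Rightarrow> 'b) \<Rightarrow> nat \<Rightarrow> 'b \<Rightarrow> 'b" where
  "comp_seq g 0 = id"
| "comp_seq g (Suc n) = g n \<circ> comp_seq g n"

definition open_covers :: "'b topology \<Rightarrow> 'b set set set" where
  "open_covers T = {\<U>. finite \<U> \<and> (\<forall>U\<in>\<U>. openin T U) \<and> \<Union>\<U> = topspace T}"

definition min_subcover :: "'b topology \<Rightarrow> 'b set set \<Rightarrow> nat" where
  "min_subcover T \<U> = (LEAST k. \<exists>\<V>. \<V> \<subseteq> \<U> \<and> \<Union>\<V> = topspace T \<and> finite \<V> \<and> card \<V> = k)"

definition preimage_cover :: "'b topology \<Rightarrow> ('b \<Rightarrow> 'b) \<Rightarrow> 'b set set \<Rightarrow> 'b set set" where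
  "preimage_cover T h \<U> = {{x \<in> topspace T. h x \<in> U} | U. U \<in> \<U>}"

text \<open>Common refinement of the covers (comp_seq g (a i))^{-1} U for i < n
  (the sequence a is indexed from 0, i.e. a i is a_{i+1} of the paper).\<close>
definition join_cover :: "'b topology \<Rightarrow> (nat \<Rightarrow> 'b \<Rightarrow> 'b) \<Rightarrow> (nat \<Rightarrow> nat) \<Rightarrow> nat \<Rightarrow> 'b set set \<Rightarrow> 'b set set" where
  "join_cover T g a n \<U> =
     {topspace T \<inter> (\<Inter>i\<in>{..<n}. V i) | V. \<forall>i<n. V i \<in> preimage_cover T (comp_seq g (a i)) \<U>}"

definition seq_entropy :: "'b topology \<Rightarrow> (nat \<Rightarrow> 'b \<Rightarrow> 'b) \<Rightarrow> (nat \<Rightarrow> nat) \<Rightarrow> ereal" where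
  "seq_entropy T g a = (SUP \<U>\<in>open_covers T.
      limsup (\<lambda>n. ereal (ln (real (min_subcover T (join_cover T g a n \<U>))) / real n)))"

definition seq_entropy_star :: "'b topology \<Rightarrow> (nat \<Rightarrow> 'b \<Rightarrow> 'b) \<Rightarrow> ereal" where
  "seq_entropy_star T g = (SUP a\<in>{a. strict_mono a}. seq_entropy T g a)"

definition prob_measures :: "'a::metric_space set \<Rightarrow> 'a measure set" where
  "prob_measures X = {M. prob_space M \<and> sets M = sets (restrict_space borel X)}"

definition weak_star_topology :: "'a::metric_space set \<Rightarrow> 'a measure topology" where
  "weak_star_topology X = topology_generated_by
     {{M \<in> prob_measures X. (\<integral>x. \<phi> x \<partial>M) \<in> U} | \<phi> U. continuous_on X \<phi> \<and> open (U::real set)}"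

definition push_forward :: "'a::metric_space set \<Rightarrow> ('a \<Rightarrow> 'a) \<Rightarrow> 'a measure \<Rightarrow> 'a measure" where
  "push_forward X f M = distr M (restrict_space borel X) f"

end

theory Submission
  imports Defs
begin

text \<open>
  Positive entropy of the base system forces infinite entropy on measures: for points
  \<open>x\<^sub>0, \<dots>, x\<^sub>k\<^sub>-\<^sub>1\<close> of a separated set \<open>E\<close> the convex combinations of the Dirac measures
  with weights proportional to \<open>2\<^sup>j\<close> are again separated, at a scale depending only on \<open>k\<close>, because
  subset sums of the weights are distinct; there are \<open>(card E)\<^sup>k\<close> of them, so the entropy is at
  least \<open>k\<close> times that of the base.

  Conversely, let the base have entropy zero.  By Maurey's empirical method every measure is
  approximated by the average of a bounded number \<open>k\<close> of Dirac measures when tested against all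
  \<open>\<phi> \<circ> f\<^sub>0\<^bsup>a\<^sub>i\<^esup>\<close>, except for a small fraction of the indices \<open>i < n\<close>.  There are
  subexponentially many \<open>k\<close>-tuples of cells, and the exceptional indices and the values there
  contribute a factor of arbitrarily small exponential rate.  Passing from test functions to
  arbitrary open covers needs weak* compactness, which follows from Tychonoff's theorem and the
  Riesz representation theorem for compact metric spaces.
\<close>

subsection \<open>The Riesz representation theorem on a compact metric space\<close>

text \<open>The exceptional indices are the price for keeping \<open>k\<close> independent of
  \<open>n\<close>. Controlling all \<open>n * card \<Phi>\<close> test functions at once by a union
  bound takes a number of samples growing like the logarithm of \<open>n\<close>, and zero entropy
  only makes the logarithm of the base covering number o(n), which does not survive a growing
  exponent. Averaged over the indices, however, the squared error of \<open>k\<close> samples is at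
  most \<open>b^2 / k\<close> whatever \<open>n\<close> is, so a fixed \<open>k\<close> misses only
  a small proportion of them.

  This dictates the order of choices: test functions and tolerance from the cover of the space of
  measures, then a cover of \<open>X\<close>, then the counting parameter \<open>t\<close> with
  \<open>ln (1 + q * t)\<close> small, then \<open>k\<close> so large that the exceptional
  proportion outweighs \<open>- ln t\<close>, and \<open>n\<close> last.

  For positive entropy the constraint is similar: entropy fixes a cover before \<open>n\<close>
  grows, so the resolution needed to separate the convex combinations must not deteriorate with the
  size of the separated set.\<close>

lemma sum_clamp:
  fixes t :: real
  assumes "0 \<le> t"
  shows "(\<Sum>j<n. min 1 (max 0 (t - real j))) = min t (real n)"
  using assms by (induction n) (auto simp: min_def max_def)

lemma continuous_positive_exactly_on_open:
  fixes U :: "'a::metric_space set"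
  assumes "open U"
  shows "\<exists>g::'a \<Rightarrow> real. continuous_on UNIV g \<and> (\<forall>x. 0 \<le> g x) \<and> (\<forall>x\<in>U. 0 < g x) \<and> (\<forall>x. x \<notin> U \<longrightarrow> g x = 0)"
\<comment> \<open>The distance to the complement fails here: \<open>infdist\<close> to the empty set
  is 0 by convention.\<close>
proof (cases "U = UNIV")
  case True
  show ?thesis by (rule exI[of _ "\<lambda>_. 1"]) (simp add: True)
next
  case False
  have c: "closed (- U)" using assms by (simp add: closed_def)
  have ne: "- U \<noteq> {}" using False by blast
  show ?thesis
  proof (intro exI[of _ "\<lambda>x. infdist x (- U)"] conjI allI ballI impI)
    show "continuous_on UNIV (\<lambda>x. infdist x (- U))" by (intro continuous_on_infdist continuous_on_id)
    show "0 \<le> infdist x (- U)" for x by (rule infdist_nonneg)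
    show "infdist x (- U) = 0" if "x \<notin> U" for x using that by (intro infdist_zero) blast
    show "0 < infdist x (- U)" if "x \<in> U" for x
    proof -
      have "infdist x (- U) \<noteq> 0" using in_closed_iff_infdist_zero[OF c ne, of x] that by blast
      then show ?thesis using infdist_nonneg[of x "- U"] by linarith
    qed
  qed
qed

text \<open>Functions are total, but the axioms see continuity and order on \<open>X\<close> only;
  so on continuous functions \<open>L\<close> depends only on the restriction to \<open>X\<close>,
  which is \<open>cong\<close>. The normalisation \<open>one\<close> will give the representing
  measure mass 1.\<close>

locale positive_functional =
  fixes X :: "'a::metric_space set" and L :: "('a \<Rightarrow> real) \<Rightarrow> real"
  assumes compact: "compact X"
    and add: "\<And>\<phi> \<psi>. continuous_on X \<phi> \<Longrightarrow> continuous_on X \<psi> \<Longrightarrow> L (\<lambda>x. \<phi> x + \<psi> x) = L \<phi> + L \<psi>"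
    and scale: "\<And>\<phi> c. continuous_on X \<phi> \<Longrightarrow> L (\<lambda>x. c * \<phi> x) = c * L \<phi>"
    and mono: "\<And>\<phi> \<psi>. continuous_on X \<phi> \<Longrightarrow> continuous_on X \<psi> \<Longrightarrow> (\<And>x. x \<in> X \<Longrightarrow> \<phi> x \<le> \<psi> x) \<Longrightarrow> L \<phi> \<le> L \<psi>"
    and one: "L (\<lambda>_. 1) = 1"
begin

lemma const: "L (\<lambda>_. c) = c"
  using scale[of "\<lambda>_. 1" c] one by simp

lemma cong: "continuous_on X \<phi> \<Longrightarrow> continuous_on X \<psi> \<Longrightarrow> (\<And>x. x \<in> X \<Longrightarrow> \<phi> x = \<psi> x) \<Longrightarrow> L \<phi> = L \<psi>"
  by (intro antisym mono) auto

lemma sum: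
  assumes "finite I" "\<And>i. i \<in> I \<Longrightarrow> continuous_on X (\<phi> i)"
  shows "L (\<lambda>x. \<Sum>i\<in>I. \<phi> i x) = (\<Sum>i\<in>I. L (\<phi> i))"
  using assms by (induction I) (auto simp: const add continuous_on_sum)

section \<open>Contents of open sets and the induced outer measure\<close>

definition admissible :: "'a set \<Rightarrow> ('a \<Rightarrow> real) set" where
  "admissible U = {\<phi>. continuous_on X \<phi> \<and> (\<forall>x\<in>X. 0 \<le> \<phi> x \<and> \<phi> x \<le> 1) \<and> (\<forall>x\<in>X - U. \<phi> x = 0)}"

definition content :: "'a set \<Rightarrow> real" where
  "content U = (SUP \<phi>\<in>admissible U. L \<phi>)"

definition outer :: "'a set \<Rightarrow> real" where
  "outer E = (INF U\<in>{U. open U \<and> E \<subseteq> U}. content U)"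

lemma admissible_bounds:
  assumes "\<phi> \<in> admissible U"
  shows "0 \<le> L \<phi>" "L \<phi> \<le> 1"
  using mono[of "\<lambda>_. 0" \<phi>] mono[of \<phi> "\<lambda>_. 1"] assms by (auto simp: admissible_def const)

lemma zero_admissible: "(\<lambda>_. 0) \<in> admissible U"
  by (simp add: admissible_def)

lemma bdd_above_admissible: "bdd_above (L ` admissible U)"
  using admissible_bounds by (auto intro!: bdd_aboveI[of _ 1])

lemma content_upper: "\<phi> \<in> admissible U \<Longrightarrow> L \<phi> \<le> content U"
  unfolding content_def by (intro cSUP_upper bdd_above_admissible)

lemma content_least: "(\<And>\<phi>. \<phi> \<in> admissible U \<Longrightarrow> L \<phi> \<le> b) \<Longrightarrow> content U \<le> b"
  unfolding content_def using zero_admissible by (intro cSUP_least) auto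

lemma content_bounds: "0 \<le> content U" "content U \<le> 1"
  by (rule order_trans[OF admissible_bounds(1) content_upper], rule zero_admissible, rule zero_admissible,
    rule content_least, rule admissible_bounds(2))

lemma outer_lower: "open U \<Longrightarrow> E \<subseteq> U \<Longrightarrow> outer E \<le> content U"
  unfolding outer_def using content_bounds by (intro cINF_lower bdd_belowI[of _ 0]) auto

lemma outer_greatest: "(\<And>U. open U \<Longrightarrow> E \<subseteq> U \<Longrightarrow> b \<le> content U) \<Longrightarrow> b \<le> outer E"
  unfolding outer_def by (intro cINF_greatest) auto

lemma outer_bounds: "0 \<le> outer E" "outer E \<le> 1"
  using outer_greatest[OF content_bounds(1)] outer_lower[of UNIV E] content_bounds(2)[of UNIV] by simp_all

lemma outer_close:
  assumes "0 < e"
  obtains U where "open U" "E \<subseteq> U" "content U < outer E + e"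
proof (rule ccontr)
  assume "\<not> thesis"
  with that have "outer E + e \<le> content U" if "open U" "E \<subseteq> U" for U
    using \<open>open U\<close> \<open>E \<subseteq> U\<close> by (meson not_less)
  then have "outer E + e \<le> outer E" by (rule outer_greatest)
  then show False using assms by simp
qed

lemma outer_mono: "E \<subseteq> F \<Longrightarrow> outer E \<le> outer F"
  by (rule outer_greatest) (auto intro: outer_lower)

lemma outer_empty: "outer {} = 0"
proof -
  have "content {} \<le> 0"
    using mono[of _ "\<lambda>_. 0"] by (intro content_least) (auto simp: admissible_def const)
  then show ?thesis
    using outer_lower[of "{}" "{}"] outer_bounds(1)[of "{}"] by auto
qed

text \<open>Admissible functions merely vanish off \<open>U\<close>. Lowering one by
  \<open>e > 0\<close> confines it to the compact set where \<open>\<phi> x \<ge> e\<close>, which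
  lies in \<open>U\<close>, and changes \<open>L\<close> by at most \<open>e\<close>; this replaces
  the usual demand of compact support.\<close>

lemma cutoff:
  assumes "\<phi> \<in> admissible U" "0 \<le> e"
  shows "(\<lambda>x. max 0 (\<phi> x - e)) \<in> admissible U" "L \<phi> \<le> e + L (\<lambda>x. max 0 (\<phi> x - e))"
proof -
  have \<phi>: "continuous_on X \<phi>" using assms by (simp add: admissible_def)
  then have c: "continuous_on X (\<lambda>x. max 0 (\<phi> x - e))" by (intro continuous_intros)
  have "\<phi> x \<le> 1 + e" "x \<notin> U \<Longrightarrow> \<phi> x \<le> e" if "x \<in> X" for x
    using assms that by (auto simp: admissible_def intro: order_trans)
  with c show "(\<lambda>x. max 0 (\<phi> x - e)) \<in> admissible U"
    by (simp add: admissible_def algebra_simps)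
  have "L \<phi> \<le> L (\<lambda>x. e + max 0 (\<phi> x - e))"
    by (intro mono \<phi> continuous_intros) auto
  also have "\<dots> = e + L (\<lambda>x. max 0 (\<phi> x - e))"
    using add[of "\<lambda>_. e"] c by (simp add: const)
  finally show "L \<phi> \<le> e + L (\<lambda>x. max 0 (\<phi> x - e))" .
qed

lemma compact_superlevel: "continuous_on X \<phi> \<Longrightarrow> compact {x \<in> X. e \<le> (\<phi> x :: real)}"
  using continuous_closedin_preimage[of X \<phi> "{e..}"] compact
  by (auto simp: vimage_def Int_def intro: closedin_compact)

text \<open>After a cutoff, a test function for the union lives on a compact set. Finitely many of
  the \<open>U i\<close> cover that set, and a partition of unity splits the function into test
  functions for these.\<close>

lemma content_Union:
  fixes U :: "nat \<Rightarrow> 'a set"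
  assumes "\<And>i. open (U i)"
  shows "ennreal (content (\<Union>i. U i)) \<le> (\<Sum>i. ennreal (content (U i)))"
proof -
  have fin: "\<exists>I. finite I \<and> L \<phi> \<le> e + (\<Sum>i\<in>I. content (U i))"
    if \<phi>: "\<phi> \<in> admissible (\<Union>i. U i)" and e: "0 < e" for \<phi> e
  proof -
    have c\<phi>: "continuous_on X \<phi>" using \<phi> by (simp add: admissible_def)
    define K where "K = {x \<in> X. e \<le> \<phi> x}"
    have "compact K" unfolding K_def using c\<phi> by (rule compact_superlevel)
    have "K \<subseteq> (\<Union>i\<in>UNIV. U i)"
    proof
      fix x assume "x \<in> K"
      then have "x \<in> X" "\<phi> x \<noteq> 0" using e by (auto simp: K_def)
      then show "x \<in> (\<Union>i\<in>UNIV. U i)" using \<phi> unfolding admissible_def by blast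
    qed
    then obtain I where "I \<subseteq> UNIV" and I: "finite I" "K \<subseteq> (\<Union>i\<in>I. U i)"
      by (rule compactE_image[OF \<open>compact K\<close> assms])
    have "\<forall>i. \<exists>g::'a \<Rightarrow> real. continuous_on UNIV g \<and> (\<forall>x. 0 \<le> g x) \<and> (\<forall>x\<in>U i. 0 < g x) \<and> (\<forall>x. x \<notin> U i \<longrightarrow> g x = 0)"
      using continuous_positive_exactly_on_open assms by blast
    from choice[OF this] obtain g :: "nat \<Rightarrow> 'a \<Rightarrow> real" where g: "\<And>i. continuous_on UNIV (g i)" "\<And>i x. 0 \<le> g i x"
        "\<And>i x. x \<in> U i \<Longrightarrow> 0 < g i x" "\<And>i x. x \<notin> U i \<Longrightarrow> g i x = 0"
      by blast
    have cg: "continuous_on X (g i)" for i using g(1) continuous_on_subset by blast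
    define h where "h = (\<lambda>x. max 0 (\<phi> x - e))"
    \<comment> \<open>The summand \<open>max 0 (e - \<phi> x)\<close> keeps the denominator positive
      on all of \<open>X\<close> and vanishes where \<open>h\<close> is positive. So the quotients
      \<open>g i x / s x\<close> are continuous on \<open>X\<close> and add up to 1 exactly where
      \<open>h\<close> has to be split.\<close>
    define s where "s = (\<lambda>x. (\<Sum>i\<in>I. g i x) + max 0 (e - \<phi> x))"
    have s: "0 < s x" if "x \<in> X" for x
    proof (cases "e \<le> \<phi> x")
      case True
      then obtain i where "i \<in> I" "x \<in> U i" using I(2) \<open>x \<in> X\<close> by (auto simp: K_def)
      then have "0 < (\<Sum>i\<in>I. g i x)" using I(1) g by (intro sum_pos2[of I i]) auto
      then show ?thesis by (auto simp: s_def)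
    next
      case False
      moreover have "0 \<le> (\<Sum>i\<in>I. g i x)" using g by (intro sum_nonneg) auto
      ultimately show ?thesis by (auto simp: s_def)
    qed
    have gs: "g i x \<le> s x" if "i \<in> I" for i x
      using member_le_sum[OF that, of "\<lambda>i. g i x"] g I(1) by (auto simp: s_def)
    define p where "p = (\<lambda>i x. h x * (g i x / s x))"
    have ch: "continuous_on X h" unfolding h_def using c\<phi> by (intro continuous_intros)
    have cs: "continuous_on X s" unfolding s_def using cg c\<phi> by (intro continuous_intros)
    have "\<forall>x\<in>X. s x \<noteq> 0" using s by fastforce
    then have cp: "continuous_on X (p i)" for i
      unfolding p_def by (intro continuous_on_mult continuous_on_divide ch cg cs)
    have h01: "0 \<le> h x" "h x \<le> 1" if "x \<in> X" for x
      using cutoff(1)[OF \<phi>, of e] e that by (auto simp: admissible_def h_def)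
    have adm: "p i \<in> admissible (U i)" if "i \<in> I" for i
    proof -
      have "0 \<le> p i x \<and> p i x \<le> 1" if "x \<in> X" for x
      proof -
        have "0 \<le> g i x / s x" "g i x / s x \<le> 1"
          using s[OF that] gs[OF \<open>i \<in> I\<close>] g by auto
        then show ?thesis using h01[OF that] unfolding p_def by (metis mult_le_one mult_nonneg_nonneg)
      qed
      moreover have "p i x = 0" if "x \<notin> U i" for x using g(4)[OF that] by (simp add: p_def)
      ultimately show ?thesis using cp by (auto simp: admissible_def)
    qed
    have "h x = (\<Sum>i\<in>I. p i x)" if "x \<in> X" for x
    proof (cases "e < \<phi> x")
      case True
      then have "(\<Sum>i\<in>I. g i x) = s x" by (simp add: s_def)
      then show ?thesis using s[OF that]
        by (simp add: p_def flip: sum_distrib_left sum_divide_distrib)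
    qed (simp add: h_def p_def)
    then have "L h = L (\<lambda>x. \<Sum>i\<in>I. p i x)"
      by (intro cong ch continuous_on_sum cp)
    also have "\<dots> = (\<Sum>i\<in>I. L (p i))" using I(1) cp by (rule sum)
    also have "\<dots> \<le> (\<Sum>i\<in>I. content (U i))" using adm by (intro sum_mono content_upper)
    finally have "L \<phi> \<le> e + (\<Sum>i\<in>I. content (U i))"
      using cutoff(2)[OF \<phi>, of e] e unfolding h_def by linarith
    then show ?thesis using I(1) by blast
  qed
  have main: "content (\<Union>i. U i) \<le> b" if b: "\<And>I. finite I \<Longrightarrow> (\<Sum>i\<in>I. content (U i)) \<le> b" for b
  proof (rule content_least)
    fix \<phi> assume "\<phi> \<in> admissible (\<Union>i. U i)"
    note \<phi> = this
    show "L \<phi> \<le> b"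
    proof (rule field_le_epsilon)
      fix e :: real assume "0 < e"
      from fin[OF \<phi> this] obtain I where "finite I" "L \<phi> \<le> e + (\<Sum>i\<in>I. content (U i))" by blast
      with b[of I] show "L \<phi> \<le> b + e" by linarith
    qed
  qed
  show ?thesis
  proof (cases "(\<Sum>i. ennreal (content (U i)))")
    case (real b)
    have "(\<Sum>i\<in>I. content (U i)) \<le> b" if "finite I" for I
    proof -
      have "ennreal (\<Sum>i\<in>I. content (U i)) = (\<Sum>i\<in>I. ennreal (content (U i)))"
        using content_bounds by (simp add: sum_ennreal)
      also have "\<dots> \<le> ennreal b" unfolding real(2)[symmetric]
        by (rule sum_le_suminf[OF summableI that]) simp
      finally show ?thesis using real(1) by simp
    qed
    then show ?thesis using main real by (simp add: ennreal_leI)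
  qed simp
qed

lemma outer_measure_space: "outer_measure_space (Pow X) (\<lambda>E. ennreal (outer E))"
  unfolding outer_measure_space_def
proof (intro conjI)
  show "positive (Pow X) (\<lambda>E. ennreal (outer E))"
    by (simp add: positive_def outer_empty)
  show "increasing (Pow X) (\<lambda>E. ennreal (outer E))"
    by (auto simp: increasing_def intro!: ennreal_leI outer_mono)
  show "countably_subadditive (Pow X) (\<lambda>E. ennreal (outer E))"
    unfolding countably_subadditive_def
  proof (intro allI impI)
    fix A :: "nat \<Rightarrow> 'a set"
    show "ennreal (outer (\<Union>i. A i)) \<le> (\<Sum>i. ennreal (outer (A i)))"
    proof (rule ennreal_le_epsilon)
      fix e :: real assume e: "0 < e"
      have "\<forall>i. \<exists>U. open U \<and> A i \<subseteq> U \<and> content U < outer (A i) + e * (1/2)^Suc i"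
      proof
        fix i
        have "0 < e * (1/2)^Suc i" using e by simp
        from outer_close[OF this] show "\<exists>U. open U \<and> A i \<subseteq> U \<and> content U < outer (A i) + e * (1/2)^Suc i"
          by blast
      qed
      from choice[OF this] obtain U where U: "\<And>i. open (U i)" "\<And>i. A i \<subseteq> U i"
          "\<And>i. content (U i) < outer (A i) + e * (1/2)^Suc i"
        by blast
      have "outer (\<Union>i. A i) \<le> content (\<Union>i. U i)"
        using U by (intro outer_lower) auto
      then have "ennreal (outer (\<Union>i. A i)) \<le> ennreal (content (\<Union>i. U i))"
        by (rule ennreal_leI)
      also have "\<dots> \<le> (\<Sum>i. ennreal (content (U i)))" using U(1) by (rule content_Union)
      also have "\<dots> \<le> (\<Sum>i. ennreal (outer (A i)) + ennreal (e * (1/2)^Suc i))"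
      proof (intro suminf_le summableI)
        fix i
        have "ennreal (content (U i)) \<le> ennreal (outer (A i) + e * (1/2)^Suc i)"
          by (rule ennreal_leI[OF less_imp_le[OF U(3)]])
        also have "\<dots> = ennreal (outer (A i)) + ennreal (e * (1/2)^Suc i)"
          using outer_bounds(1) e by (intro ennreal_plus) auto
        finally show "ennreal (content (U i)) \<le> ennreal (outer (A i)) + ennreal (e * (1/2)^Suc i)" .
      qed
      also have "\<dots> = (\<Sum>i. ennreal (outer (A i))) + (\<Sum>i. ennreal (e * (1/2)^Suc i))"
        by (intro suminf_add[symmetric] summableI)
      also have "(\<Sum>i. ennreal (e * (1/2)^Suc i)) = ennreal e"
      proof (rule suminf_ennreal_eq)
        show "(\<lambda>i. e * (1/2)^Suc i) sums e"
          using sums_mult[OF power_half_series, of e] by (simp only: mult_1_right)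
      qed (use e in simp)
      finally show "ennreal (outer (\<Union>i. A i)) \<le> (\<Sum>i. ennreal (outer (A i))) + ennreal e" .
    qed
  qed
qed

text \<open>A test function of \<open>V \<inter> U\<close>, after a cutoff, lives on a compact
  \<open>K \<subseteq> U\<close>. Then \<open>V - K\<close> is still an open neighbourhood of
  \<open>E - U\<close>, and a test function of \<open>V - K\<close> can be added to the first one
  without exceeding 1, since at every point one of the two is 0.\<close>

lemma outer_split_open:
  assumes "open U"
  shows "outer (E \<inter> U) + outer (E - U) \<le> outer E"
proof (rule outer_greatest)
  fix V assume V: "open V" "E \<subseteq> V"
  have "L \<phi> \<le> content V - outer (E - U)" if \<phi>: "\<phi> \<in> admissible (V \<inter> U)" for \<phi>
  proof (rule field_le_epsilon)
    fix e :: real assume e: "0 < e"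
    have c\<phi>: "continuous_on X \<phi>" using \<phi> by (simp add: admissible_def)
    define K where "K = {x \<in> X. e \<le> \<phi> x}"
    define h where "h = (\<lambda>x. max 0 (\<phi> x - e))"
    have "compact K" unfolding K_def using c\<phi> by (rule compact_superlevel)
    then have W: "open (V - K)" using V by (intro open_Diff compact_imp_closed)
    have "K \<subseteq> U" using \<phi> e by (force simp: K_def admissible_def)
    then have "outer (E - U) \<le> content (V - K)" using V W by (intro outer_lower) auto
    moreover have "content (V - K) \<le> content V - L h"
    proof (rule content_least)
      fix \<psi> assume \<psi>: "\<psi> \<in> admissible (V - K)"
      have h: "h \<in> admissible (V \<inter> U)" unfolding h_def using cutoff(1)[OF \<phi>] e by simp
      have *: "h x = 0 \<or> \<psi> x = 0" if "x \<in> X" for x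
        using \<psi> that by (cases "x \<in> K") (auto simp: admissible_def K_def h_def)
      have "(\<lambda>x. \<psi> x + h x) \<in> admissible V"
        using h \<psi> * unfolding admissible_def
        by (auto intro!: continuous_intros) (metis add.right_neutral add_0_left)
      moreover have "L (\<lambda>x. \<psi> x + h x) = L \<psi> + L h"
        using h \<psi> by (intro add) (auto simp: admissible_def)
      ultimately show "L \<psi> \<le> content V - L h" using content_upper by force
    qed
    ultimately show "L \<phi> \<le> content V - outer (E - U) + e"
      using cutoff(2)[OF \<phi>, of e] e by (auto simp: h_def)
  qed
  then have "content (V \<inter> U) \<le> content V - outer (E - U)" by (rule content_least)
  moreover have "outer (E \<inter> U) \<le> content (V \<inter> U)" using V assms by (intro outer_lower) auto
  ultimately show "outer (E \<inter> U) + outer (E - U) \<le> content V" by simp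
qed

section \<open>Caratheodory's construction and the representation formula\<close>

definition representing_measure :: "'a measure" where
  "representing_measure = measure_of X (sets (restrict_space borel X)) (\<lambda>E. ennreal (outer E))"

lemma sets_representing_measure: "sets representing_measure = sets (restrict_space borel X)"
  and space_representing_measure: "space representing_measure = X"
proof -
  have *: "space (restrict_space borel X) = X" by (simp add: space_restrict_space)
  then have "sets (restrict_space borel X) \<subseteq> Pow X" using sets.space_closed by metis
  moreover have "sigma_sets X (sets (restrict_space borel X)) = sets (restrict_space borel X)"
    using sets.sigma_sets_eq[of "restrict_space borel X"] * by simp
  ultimately show "sets representing_measure = sets (restrict_space borel X)"
      "space representing_measure = X"
    by (simp_all add: representing_measure_def)
qed

text \<open>\<open>measure_of\<close> yields the zero measure unless the given function is countably
  additive on the generated sets. Caratheodory's lemma gives this on the sets that split every set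
  additively, and \<open>outer_split_open\<close> puts the traces of open sets among them.\<close>

lemma emeasure_representing_measure:
  assumes "E \<in> sets (restrict_space borel X)"
  shows "emeasure representing_measure E = ennreal (outer E)"
proof -
  define \<Lambda> where "\<Lambda> = lambda_system X (Pow X) (\<lambda>E. ennreal (outer E))"
  have ms: "measure_space X \<Lambda> (\<lambda>E. ennreal (outer E))"
    unfolding \<Lambda>_def
    by (rule sigma_algebra.caratheodory_lemma[OF sigma_algebra_Pow outer_measure_space])
  then have sa: "sigma_algebra X \<Lambda>" by (simp add: measure_space_def)
  have open_in: "X \<inter> U \<in> \<Lambda>" if "open U" for U
  proof -
    have "ennreal (outer (E \<inter> (X \<inter> U))) + ennreal (outer (E - (X \<inter> U))) = ennreal (outer E)"
      if "E \<subseteq> X" for E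
    proof -
      have "E \<inter> (X \<inter> U) = E \<inter> U" "E - (X \<inter> U) = E - U" using that by auto
      moreover have "ennreal (outer E) \<le> ennreal (outer (E \<inter> U)) + ennreal (outer (E - U))"
      proof -
        have "subadditive (Pow X) (\<lambda>E. ennreal (outer E))"
          using outer_measure_space
          by (intro ring_of_sets.countably_subadditive_subadditive[OF ring_of_sets_Pow])
            (auto simp: outer_measure_space_def)
        moreover have "(E \<inter> U) \<union> (E - U) = E" "(E \<inter> U) \<inter> (E - U) = {}" by auto
        ultimately show ?thesis using that unfolding subadditive_def
          by (metis Diff_subset Int_lower1 PowI order_trans)
      qed
      moreover have "ennreal (outer (E \<inter> U)) + ennreal (outer (E - U)) \<le> ennreal (outer E)"
        using outer_split_open[OF \<open>open U\<close>, of E] outer_bounds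
        by (simp flip: ennreal_plus add: ennreal_leI)
      ultimately show ?thesis by (simp add: antisym)
    qed
    then show ?thesis
      unfolding \<Lambda>_def algebra.lambda_system_eq[OF algebra_Pow] by auto
  qed
  \<comment> \<open>The induction runs over Borel sets of the whole type and carries along their
    traces on \<open>X\<close>; complements in \<open>UNIV\<close> become complements in
    \<open>X\<close>.\<close>
  have *: "X \<inter> B \<in> \<Lambda>" if "B \<in> sigma_sets UNIV {S. open S}" for B
    using that
  proof induction
    case Empty
    then show ?case using sa by (simp add: sigma_algebra_iff2)
  next
    case (Compl B)
    then have "X - (X \<inter> B) \<in> \<Lambda>" using sa by (auto simp: sigma_algebra_iff2)
    moreover have "X - (X \<inter> B) = X \<inter> (UNIV - B)" by auto
    ultimately show ?case by simp
  next
    case (Union B)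
    then have "range (\<lambda>i. X \<inter> B i) \<subseteq> \<Lambda>" by auto
    then have "(\<Union>i. X \<inter> B i) \<in> \<Lambda>" using sa unfolding sigma_algebra_iff2 by blast
    then show ?case by simp
  qed (auto intro: open_in)
  have sub: "sets (restrict_space borel X) \<subseteq> \<Lambda>"
    using * by (auto simp: sets_restrict_space borel_def)
  have "space (restrict_space borel X) = X" by (simp add: space_restrict_space)
  then have "sigma_algebra X (sets (restrict_space borel X))"
    using sets.sigma_algebra_axioms[of "restrict_space borel X"] by simp
  with measure_down[OF ms _ sub] assms show ?thesis
    unfolding representing_measure_def
    by (intro emeasure_measure_of_sigma) (auto simp: measure_space_def)
qed

lemma representing_measure_in_prob_measures: "representing_measure \<in> prob_measures X"
proof -
  have "outer X = 1"
  proof (rule antisym)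
    show "1 \<le> outer X"
    proof (rule outer_greatest)
      fix U assume "X \<subseteq> U"
      then have "(\<lambda>_. 1) \<in> admissible U" by (auto simp: admissible_def)
      then show "1 \<le> content U" using content_upper one by force
    qed
  qed (rule outer_bounds)
  moreover have "X \<in> sets (restrict_space borel X)"
    using sets.top[of "restrict_space borel X"] by (simp add: space_restrict_space)
  ultimately have "emeasure representing_measure (space representing_measure) = 1"
    by (simp add: emeasure_representing_measure space_representing_measure)
  then show ?thesis
    by (auto simp: prob_measures_def sets_representing_measure intro: prob_spaceI)
qed

text \<open>\<open>\<phi>\<close> is a test function for every open set that contains the set where
  it is positive. The bound is crude for \<open>\<phi>\<close> itself but precise enough for the
  thin horizontal slices of the next lemma.\<close>

lemma le_measure_positivity_set:
  assumes \<phi>: "continuous_on X \<phi>" "\<And>x. x \<in> X \<Longrightarrow> 0 \<le> \<phi> x \<and> \<phi> x \<le> 1"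
  shows "{x \<in> X. 0 < \<phi> x} \<in> sets (restrict_space borel X)"
    "L \<phi> \<le> measure representing_measure {x \<in> X. 0 < \<phi> x}"
proof -
  obtain U where U: "open U" "U \<inter> X = \<phi> -` {0<..} \<inter> X"
    using \<phi>(1) open_greaterThan unfolding continuous_on_open_invariant by blast
  then have eq: "{x \<in> X. 0 < \<phi> x} = X \<inter> U" by auto
  then show m: "{x \<in> X. 0 < \<phi> x} \<in> sets (restrict_space borel X)"
    using U(1) by (auto simp: sets_restrict_space)
  have "L \<phi> \<le> outer {x \<in> X. 0 < \<phi> x}"
    using \<phi> by (intro outer_greatest content_upper) (force simp: admissible_def)
  then show "L \<phi> \<le> measure representing_measure {x \<in> X. 0 < \<phi> x}"
    using m outer_bounds by (simp add: measure_def emeasure_representing_measure)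
qed

lemma le_integral:
  assumes \<phi>: "continuous_on X \<phi>" "\<And>x. x \<in> X \<Longrightarrow> 0 \<le> \<phi> x \<and> \<phi> x \<le> 1"
  shows "L \<phi> \<le> (\<integral>x. \<phi> x \<partial>representing_measure)"
proof (rule field_le_epsilon)
  fix e :: real assume "0 < e"
  then obtain m where "inverse (real (Suc m)) < e" using reals_Archimedean by blast
  then obtain n :: nat where n: "0 < n" "1 / real n < e"
    by (metis inverse_eq_divide zero_less_Suc)
  interpret M: prob_space representing_measure
    using representing_measure_in_prob_measures by (simp add: prob_measures_def)
  \<comment> \<open>These are the horizontal slices of height 1 of the graph of
    \<open>n * \<phi>\<close>; slice \<open>j\<close> is positive exactly where
    \<open>n * \<phi> x > j\<close>.\<close>
  define clamp where "clamp = (\<lambda>j x. min 1 (max 0 (real n * \<phi> x - real j)))"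
  define D where "D = (\<lambda>j. {x \<in> X. 0 < clamp j x})"
  have c: "continuous_on X (clamp j)" for j
    unfolding clamp_def using \<phi>(1) by (intro continuous_intros)
  have D: "D j \<in> sets representing_measure" "L (clamp j) \<le> M.prob (D j)" for j
    using le_measure_positivity_set[OF c[of j]]
    by (auto simp: clamp_def D_def sets_representing_measure)
  have meas: "\<phi> \<in> borel_measurable representing_measure"
    using borel_measurable_continuous_on_restrict[OF \<phi>(1)]
      measurable_cong_sets[OF sets_representing_measure refl] by blast
  have int: "integrable representing_measure \<phi>"
    using \<phi>(2) by (intro M.integrable_const_bound[of _ 1] meas) (auto simp: space_representing_measure)
  have "real n * L \<phi> = L (\<lambda>x. real n * \<phi> x)" using scale \<phi>(1) by simp
  also have "\<dots> = L (\<lambda>x. \<Sum>j<n. clamp j x)"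
  proof (rule cong)
    fix x assume "x \<in> X"
    then show "real n * \<phi> x = (\<Sum>j<n. clamp j x)"
      using \<phi>(2)[of x] sum_clamp[of "real n * \<phi> x" n]
      by (auto simp: clamp_def min_def mult_left_le)
  qed (use c \<phi>(1) in \<open>auto intro!: continuous_intros\<close>)
  also have "\<dots> = (\<Sum>j<n. L (clamp j))" using c by (intro sum) auto
  also have "\<dots> \<le> (\<Sum>j<n. M.prob (D j))" using D by (intro sum_mono)
  also have "\<dots> = (\<integral>x. (\<Sum>j<n. indicator (D j) x) \<partial>representing_measure)"
    using D(1) by (subst Bochner_Integration.integral_sum) (auto simp: M.emeasure_eq_measure)
  also have "\<dots> \<le> (\<integral>x. real n * \<phi> x + 1 \<partial>representing_measure)"
  proof (rule integral_mono)
    fix x assume "x \<in> space representing_measure"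
    then have x: "x \<in> X" by (simp add: space_representing_measure)
    \<comment> \<open>On \<open>D j\<close> the number \<open>n * \<phi> x + 1 - j\<close> exceeds
      1, so the slice of the function raised by 1 is already full there. The raise costs 1 in total,
      hence \<open>1 / n\<close> after rescaling.\<close>
    have "(\<Sum>j<n. indicator (D j) x) \<le> (\<Sum>j<n. min 1 (max 0 (real n * \<phi> x + 1 - real j)))"
      by (intro sum_mono) (auto simp: indicator_def D_def clamp_def)
    also have "\<dots> \<le> real n * \<phi> x + 1"
      using \<phi>(2)[OF x] by (subst sum_clamp) auto
    finally show "(\<Sum>j<n. indicator (D j) x) \<le> real n * \<phi> x + 1" .
  qed (use int D(1) in \<open>auto simp: M.emeasure_eq_measure\<close>)
  also have "\<dots> = real n * (\<integral>x. \<phi> x \<partial>representing_measure) + 1"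
    using int by (simp add: M.prob_space)
  finally have "L \<phi> \<le> (\<integral>x. \<phi> x \<partial>representing_measure) + 1 / real n"
    using n by (simp add: field_simps)
  then show "L \<phi> \<le> (\<integral>x. \<phi> x \<partial>representing_measure) + e" using n by simp
qed

text \<open>An affine rescaling brings any continuous function into the range \<open>[0, 1]\<close>
  of \<open>le_integral\<close>. One inequality is enough, since applied to the negative of
  \<open>\<phi>\<close> it reverses.\<close>

theorem integral_representing_measure:
  assumes \<phi>: "continuous_on X \<phi>"
  shows "(\<integral>x. \<phi> x \<partial>representing_measure) = L \<phi>"
proof -
  interpret M: prob_space representing_measure
    using representing_measure_in_prob_measures by (simp add: prob_measures_def)
  have le: "L \<phi> \<le> (\<integral>x. \<phi> x \<partial>representing_measure)" and int: "integrable representing_measure \<phi>"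
    if \<phi>: "continuous_on X \<phi>" for \<phi>
  proof -
    have "bounded (\<phi> ` X)" using \<phi> compact by (intro compact_imp_bounded compact_continuous_image)
    then obtain B where B: "0 < B" "\<And>x. x \<in> X \<Longrightarrow> \<bar>\<phi> x\<bar> \<le> B"
      by (metis bounded_pos image_eqI real_norm_def)
    have meas: "\<phi> \<in> borel_measurable representing_measure"
      using borel_measurable_continuous_on_restrict[OF \<phi>]
        measurable_cong_sets[OF sets_representing_measure refl] by blast
    show int: "integrable representing_measure \<phi>"
      using B by (intro M.integrable_const_bound[of _ B] meas) (auto simp: space_representing_measure)
    define \<psi> where "\<psi> = (\<lambda>x. 1 / (2 * B) * \<phi> x + 1/2)"
    have "0 \<le> \<psi> x \<and> \<psi> x \<le> 1" if "x \<in> X" for x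
      using B(1) B(2)[OF that] by (auto simp: \<psi>_def field_simps)
    moreover have "continuous_on X \<psi>" unfolding \<psi>_def using \<phi> by (intro continuous_intros)
    ultimately have "L \<psi> \<le> (\<integral>x. \<psi> x \<partial>representing_measure)" by (intro le_integral)
    moreover have "L \<psi> = 1 / (2 * B) * L \<phi> + 1/2"
      using add[of "\<lambda>x. 1 / (2 * B) * \<phi> x" "\<lambda>_. 1/2"] scale[OF \<phi>, of "1 / (2 * B)"] \<phi>
      by (simp add: \<psi>_def const continuous_on_mult_left del: times_divide_eq_left)
    moreover have "(\<integral>x. \<psi> x \<partial>representing_measure) = 1 / (2 * B) * (\<integral>x. \<phi> x \<partial>representing_measure) + 1/2"
      using int by (simp add: \<psi>_def M.prob_space)
    ultimately show "L \<phi> \<le> (\<integral>x. \<phi> x \<partial>representing_measure)"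
      using B(1) by (simp add: divide_le_cancel)
  qed
  have "L (\<lambda>x. - \<phi> x) = - L \<phi>" using scale[OF \<phi>, of "-1"] by simp
  then have "L \<phi> \<ge> (\<integral>x. \<phi> x \<partial>representing_measure)"
    using le[of "\<lambda>x. - \<phi> x"] \<phi> by (simp add: continuous_on_minus)
  with le[OF \<phi>] show ?thesis by simp
qed

end

subsection \<open>Weak* compactness\<close>

lemma space_prob_measures: "M \<in> prob_measures X \<Longrightarrow> space M = X"
  using sets_eq_imp_space_eq[of M "restrict_space borel X"]
  by (simp add: prob_measures_def space_restrict_space)

lemma measurable_prob_measures:
  fixes \<phi> :: "'a::metric_space \<Rightarrow> real"
  assumes "M \<in> prob_measures X" "continuous_on X \<phi>"
  shows "\<phi> \<in> borel_measurable M"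
proof -
  have "sets M = sets (restrict_space borel X)" using assms by (simp add: prob_measures_def)
  then show ?thesis
    using borel_measurable_continuous_on_restrict[OF assms(2)] measurable_cong_sets[OF _ refl] by blast
qed

lemma continuous_on_compact_bounded:
  fixes \<phi> :: "'a::metric_space \<Rightarrow> real"
  assumes "compact X" "continuous_on X \<phi>"
  obtains b where "0 < b" "\<And>x. x \<in> X \<Longrightarrow> \<bar>\<phi> x\<bar> \<le> b"
proof -
  have "bounded (\<phi> ` X)" using assms by (intro compact_imp_bounded compact_continuous_image)
  then show ?thesis using that by (metis bounded_pos image_eqI real_norm_def)
qed

lemma integrable_prob_measures:
  fixes \<phi> :: "'a::metric_space \<Rightarrow> real"
  assumes "compact X" "M \<in> prob_measures X" "continuous_on X \<phi>"
  shows "integrable M \<phi>"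
proof -
  interpret prob_space M using assms by (simp add: prob_measures_def)
  obtain b where "\<And>x. x \<in> X \<Longrightarrow> \<bar>\<phi> x\<bar> \<le> b" using continuous_on_compact_bounded assms by metis
  then show ?thesis
    using measurable_prob_measures[OF assms(2,3)] space_prob_measures[OF assms(2)]
    by (intro integrable_const_bound[of _ b]) auto
qed

lemma topspace_weak_star: "topspace (weak_star_topology X) = prob_measures X"
proof -
  have "prob_measures X \<in> {{M \<in> prob_measures X. (\<integral>x. \<phi> x \<partial>M) \<in> U} | \<phi> U.
      continuous_on X \<phi> \<and> open (U::real set)}"
    by (intro CollectI exI[of _ "\<lambda>_. 0"] exI[of _ UNIV]) auto
  then show ?thesis
    unfolding weak_star_topology_def topology_generated_by_topspace by auto
qed

lemma openin_weak_star_subbasic: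
  "continuous_on X \<phi> \<Longrightarrow> open (U::real set) \<Longrightarrow>
    openin (weak_star_topology X) {M \<in> prob_measures X. (\<integral>x. \<phi> x \<partial>M) \<in> U}"
  unfolding weak_star_topology_def by (rule topology_generated_by_Basis) auto

section \<open>Neighbourhoods given by finitely many test functions\<close>

definition weak_ball :: "'a::metric_space set \<Rightarrow> ('a \<Rightarrow> real) set \<Rightarrow> real \<Rightarrow> 'a measure \<Rightarrow> 'a measure set" where
  "weak_ball X \<Phi> e M = {M' \<in> prob_measures X. \<forall>\<phi>\<in>\<Phi>. \<bar>(\<integral>x. \<phi> x \<partial>M') - (\<integral>x. \<phi> x \<partial>M)\<bar> < e}"

lemma openin_weak_ball:
  assumes "finite \<Phi>" "\<And>\<phi>. \<phi> \<in> \<Phi> \<Longrightarrow> continuous_on X \<phi>"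
  shows "openin (weak_star_topology X) (weak_ball X \<Phi> e M)"
proof -
  \<comment> \<open>The factor \<open>prob_measures X\<close> matters for empty
    \<open>\<Phi>\<close>, where the intersection alone would be \<open>UNIV\<close>.\<close>
  have "weak_ball X \<Phi> e M =
    prob_measures X \<inter> (\<Inter>\<phi>\<in>\<Phi>. {M' \<in> prob_measures X. (\<integral>x. \<phi> x \<partial>M') \<in> ball (\<integral>x. \<phi> x \<partial>M) e})"
    by (auto simp: weak_ball_def dist_real_def abs_minus_commute)
  moreover have "openin (weak_star_topology X) \<dots>"
  proof (cases "\<Phi> = {}")
    case True
    then show ?thesis
      using openin_topspace[of "weak_star_topology X"] by (simp add: topspace_weak_star)
  next
    case False
    then show ?thesis
      using assms openin_topspace[of "weak_star_topology X"] unfolding topspace_weak_star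
      by (intro openin_Int openin_INT2 openin_weak_star_subbasic open_ball) auto
  qed
  ultimately show ?thesis by simp
qed

lemma openin_weak_star_contains_weak_ball:
  assumes "openin (weak_star_topology X) U" "M \<in> U"
  obtains \<Phi> e where "finite \<Phi>" "\<And>\<phi>. \<phi> \<in> \<Phi> \<Longrightarrow> continuous_on X \<phi>" "0 < e" "weak_ball X \<Phi> e M \<subseteq> U"
proof -
  have "generate_topology_on {{M \<in> prob_measures X. (\<integral>x. \<phi> x \<partial>M) \<in> U} | \<phi> U.
      continuous_on X \<phi> \<and> open (U::real set)} U"
    using assms(1) unfolding weak_star_topology_def by (rule openin_topology_generated_by)
  then have "\<exists>\<Phi> e. finite \<Phi> \<and> (\<forall>\<phi>\<in>\<Phi>. continuous_on X \<phi>) \<and> 0 < e \<and> weak_ball X \<Phi> e M \<subseteq> U"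
    using assms(2)
  proof (induction rule: generate_topology_on.induct)
    case (Int a b)
    then obtain \<Phi> e \<Psi> d where "finite \<Phi>" "\<forall>\<phi>\<in>\<Phi>. continuous_on X \<phi>" "0 < e" "weak_ball X \<Phi> e M \<subseteq> a"
        "finite \<Psi>" "\<forall>\<phi>\<in>\<Psi>. continuous_on X \<phi>" "0 < d" "weak_ball X \<Psi> d M \<subseteq> b"
      by auto
    moreover from this have "weak_ball X (\<Phi> \<union> \<Psi>) (min d e) M \<subseteq> a \<inter> b"
      unfolding weak_ball_def by fastforce
    ultimately show ?case
      by (intro exI[of _ "\<Phi> \<union> \<Psi>"] exI[of _ "min d e"] conjI) (simp_all add: ball_Un)
  next
    case (UN K)
    then show ?case by (meson Union_iff Union_upper order_trans)
  next
    case (Basis s)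
    then obtain \<phi> V where s: "continuous_on X \<phi>" "open (V::real set)" "s = {M \<in> prob_measures X. (\<integral>x. \<phi> x \<partial>M) \<in> V}"
      by blast
    then obtain e where "0 < e" "ball (\<integral>x. \<phi> x \<partial>M) e \<subseteq> V"
      using Basis.prems open_contains_ball by blast
    moreover from this have "weak_ball X {\<phi>} e M \<subseteq> s"
      unfolding s(3) weak_ball_def by (auto simp: dist_real_def abs_minus_commute)
    ultimately show ?case using s(1) by (intro exI[of _ "{\<phi>}"] exI[of _ e]) simp
  qed auto
  then show ?thesis using that by blast
qed

text \<open>Continuous functions determine a Borel probability measure, but it is enough here that
  open sets cannot tell two measures with equal integrals apart.\<close>

lemma openin_weak_star_same_integrals:
  fixes X :: "'a::metric_space set"
  assumes "openin (weak_star_topology X) U" "M \<in> U" "M' \<in> prob_measures X"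
    and "\<And>\<phi>::'a \<Rightarrow> real. continuous_on X \<phi> \<Longrightarrow> (\<integral>x. \<phi> x \<partial>M') = (\<integral>x. \<phi> x \<partial>M)"
  shows "M' \<in> U"
proof -
  obtain \<Phi> e where \<Phi>: "\<And>\<phi>. \<phi> \<in> \<Phi> \<Longrightarrow> continuous_on X \<phi>" "0 < e" "weak_ball X \<Phi> e M \<subseteq> U"
    using openin_weak_star_contains_weak_ball[OF assms(1,2)] by metis
  have "M' \<in> weak_ball X \<Phi> e M" using assms(3,4) \<Phi>(1,2) by (simp add: weak_ball_def)
  then show ?thesis using \<Phi>(3) by blast
qed

text \<open>Every axiom of a normalised positive functional is a closed condition on finitely many
  coordinates, so these functionals form a closed subset \<open>K\<close> of a product of compact
  intervals. The Riesz map \<open>T\<close> sends \<open>K\<close> continuously to measures.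
  Finitely many open sets that cover its image cover all measures, because \<open>M\<close> has the
  same integrals as the image under \<open>T\<close> of its own integration functional and therefore
  lies in the same open sets.\<close>

theorem compact_space_weak_star:
  fixes X :: "'a::metric_space set"
  assumes X: "compact X"
  shows "compact_space (weak_star_topology X)"
proof -
  define I where "I = {\<phi>::'a \<Rightarrow> real. continuous_on X \<phi>}"
  have "\<forall>\<phi>\<in>I. \<exists>b. \<forall>x\<in>X. \<bar>\<phi> x\<bar> \<le> b"
  proof
    fix \<phi> assume "\<phi> \<in> I"
    then have "continuous_on X \<phi>" by (simp add: I_def)
    from continuous_on_compact_bounded[OF X this] show "\<exists>b. \<forall>x\<in>X. \<bar>\<phi> x\<bar> \<le> b" by metis
  qed
  from bchoice[OF this] obtain b where b: "\<And>\<phi> x. \<phi> \<in> I \<Longrightarrow> x \<in> X \<Longrightarrow> \<bar>\<phi> x\<bar> \<le> b \<phi>" by blast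
  \<comment> \<open>The coordinate at \<open>\<phi>\<close> ranges over an interval given by a bound
    of \<open>\<phi>\<close> on \<open>X\<close>, which contains the integral of
    \<open>\<phi>\<close> against any probability measure.\<close>
  define Q where "Q = product_topology (\<lambda>\<phi>. top_of_set {- b \<phi>..b \<phi>}) I"
  have "compact_space Q" by (simp add: Q_def compact_space_product_topology compact_space_subtopology)
  have eval: "continuous_map Q euclideanreal (\<lambda>L. L \<phi>)" if "\<phi> \<in> I" for \<phi>
    using continuous_map_product_projection[OF that, of "\<lambda>\<phi>. top_of_set {- b \<phi>..b \<phi>}"]
    by (simp add: Q_def continuous_map_in_subtopology)
  define A where "A = (\<lambda>\<phi> \<psi>. {L \<in> topspace Q. L (\<lambda>x. \<phi> x + \<psi> x) - (L \<phi> + L \<psi>) \<in> {0}})"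
  define S where "S = (\<lambda>\<phi> c. {L \<in> topspace Q. L (\<lambda>x. c * \<phi> x) - c * L \<phi> \<in> {0}})"
  define P where "P = (\<lambda>\<phi> \<psi>. {L \<in> topspace Q. L \<psi> - L \<phi> \<in> {0..}})"
  define N where "N = {L \<in> topspace Q. L (\<lambda>_. 1) \<in> {1}}"
  define J where "J = {(\<phi>, \<psi>). \<phi> \<in> I \<and> \<psi> \<in> I \<and> (\<forall>x\<in>X. \<phi> x \<le> \<psi> x)}"
  define K where "K = N \<inter> (\<Inter>\<phi>\<in>I. \<Inter>\<psi>\<in>I. A \<phi> \<psi>) \<inter> (\<Inter>\<phi>\<in>I. \<Inter>c. S \<phi> c) \<inter> (\<Inter>(\<phi>, \<psi>)\<in>J. P \<phi> \<psi>)"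
  have plus_I: "(\<lambda>x. \<phi> x + \<psi> x) \<in> I" if "\<phi> \<in> I" "\<psi> \<in> I" for \<phi> \<psi>
    using that by (auto simp: I_def intro: continuous_intros)
  have scale_I: "(\<lambda>x. c * \<phi> x) \<in> I" if "\<phi> \<in> I" for \<phi> c
    using that by (auto simp: I_def intro: continuous_intros)
  have one_I: "(\<lambda>_. 1) \<in> I" by (simp add: I_def)
  have pre: "closedin Q {L \<in> topspace Q. h L \<in> C}"
    if "continuous_map Q euclideanreal h" "closed C" for h and C :: "real set"
    using closedin_continuous_map_preimage[OF that(1), of C] that(2) by simp
  have "closedin Q (A \<phi> \<psi>)" if "\<phi> \<in> I" "\<psi> \<in> I" for \<phi> \<psi>
    unfolding A_def
    by (intro pre continuous_map_diff[OF eval continuous_map_add[OF eval eval]] plus_I that) simp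
  moreover have "closedin Q (S \<phi> c)" if "\<phi> \<in> I" for \<phi> c
    unfolding S_def
    by (intro pre continuous_map_diff[OF eval continuous_map_real_mult_left[OF eval]] scale_I that) simp
  moreover have "closedin Q (P \<phi> \<psi>)" if "\<phi> \<in> I" "\<psi> \<in> I" for \<phi> \<psi>
    unfolding P_def by (intro pre continuous_map_diff[OF eval eval] that) simp
  moreover have "closedin Q N"
    unfolding N_def by (intro pre eval one_I) simp
  moreover have "I \<noteq> {}" "J \<noteq> {}" using one_I by (auto simp: J_def)
  ultimately have "closedin Q K"
    unfolding K_def by (intro closedin_Int closedin_INT) (auto simp: J_def)
  then have compK: "compactin Q K"
    using \<open>compact_space Q\<close> by (rule closedin_compact_space[rotated])
  have K_iff: "L \<in> K \<longleftrightarrow> L \<in> topspace Q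
      \<and> (\<forall>\<phi>\<in>I. \<forall>\<psi>\<in>I. L (\<lambda>x. \<phi> x + \<psi> x) = L \<phi> + L \<psi>)
      \<and> (\<forall>\<phi>\<in>I. \<forall>c. L (\<lambda>x. c * \<phi> x) = c * L \<phi>)
      \<and> (\<forall>\<phi>\<in>I. \<forall>\<psi>\<in>I. (\<forall>x\<in>X. \<phi> x \<le> \<psi> x) \<longrightarrow> L \<phi> \<le> L \<psi>) \<and> L (\<lambda>_. 1) = 1" for L
    unfolding K_def N_def A_def S_def P_def J_def by auto
  have pf: "positive_functional X L" if "L \<in> K" for L
    using that X unfolding K_iff I_def by unfold_locales auto
  define T where "T = positive_functional.representing_measure X"
  have T: "T L \<in> prob_measures X" "\<phi> \<in> I \<Longrightarrow> (\<integral>x. \<phi> x \<partial>T L) = L \<phi>" if "L \<in> K" for L \<phi>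
    using positive_functional.representing_measure_in_prob_measures[OF pf[OF that]]
      positive_functional.integral_representing_measure[OF pf[OF that]]
    by (auto simp: T_def I_def)
  have top: "topspace (subtopology Q K) = K"
    using closedin_subset[OF \<open>closedin Q K\<close>] by auto
  have cont: "continuous_map (subtopology Q K) (weak_star_topology X) T"
    unfolding weak_star_topology_def
  proof (rule continuous_on_generated_topo)
    fix U assume "U \<in> {{M \<in> prob_measures X. (\<integral>x. \<phi> x \<partial>M) \<in> U} | \<phi> U.
      continuous_on X \<phi> \<and> open (U::real set)}"
    then obtain \<phi> V where U: "\<phi> \<in> I" "open (V::real set)" "U = {M \<in> prob_measures X. (\<integral>x. \<phi> x \<partial>M) \<in> V}"
      by (auto simp: I_def)
    have "T -` U \<inter> topspace (subtopology Q K) = {L \<in> topspace Q. L \<phi> \<in> V} \<inter> K"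
      unfolding top using T U closedin_subset[OF \<open>closedin Q K\<close>] by auto
    moreover have "openin Q {L \<in> topspace Q. L \<phi> \<in> V}"
      using openin_continuous_map_preimage[OF eval[OF U(1)], of V] U(2) by simp
    ultimately show "openin (subtopology Q K) (T -` U \<inter> topspace (subtopology Q K))"
      by (auto simp: openin_subtopology)
  next
    show "T ` topspace (subtopology Q K) \<subseteq> \<Union> {{M \<in> prob_measures X. (\<integral>x. \<phi> x \<partial>M) \<in> U} | \<phi> U.
      continuous_on X \<phi> \<and> open (U::real set)}"
      using T(1) topspace_weak_star[of X] unfolding top weak_star_topology_def by auto
  qed
  have "compactin (subtopology Q K) K" using compK by (simp add: compactin_subtopology)
  then have compT: "compactin (weak_star_topology X) (T ` K)" using cont by (rule image_compactin)
  have repr: "\<exists>L\<in>K. \<forall>\<phi>\<in>I. (\<integral>x. \<phi> x \<partial>M) = L \<phi>" if M: "M \<in> prob_measures X" for M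
  proof (intro bexI ballI)
    interpret prob_space M using M by (simp add: prob_measures_def)
    \<comment> \<open>Points of a product topology are extensional functions, hence the restriction
      to \<open>I\<close>.\<close>
    let ?L = "\<lambda>\<phi>\<in>I. (\<integral>x. \<phi> x \<partial>M)"
    have int: "integrable M \<phi>" if "\<phi> \<in> I" for \<phi>
      using integrable_prob_measures[OF X M] that by (simp add: I_def)
    have mono: "(\<integral>x. \<phi> x \<partial>M) \<le> (\<integral>x. \<psi> x \<partial>M)" if "\<phi> \<in> I" "\<psi> \<in> I" "\<forall>x\<in>X. \<phi> x \<le> \<psi> x" for \<phi> \<psi>
      using int that by (intro integral_mono) (auto simp: space_prob_measures[OF M])
    have const_I: "(\<lambda>_. c) \<in> I" for c by (simp add: I_def)
    have "\<bar>\<integral>x. \<phi> x \<partial>M\<bar> \<le> b \<phi>" if "\<phi> \<in> I" for \<phi>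
      using mono[OF that const_I[of "b \<phi>"]] mono[OF const_I[of "- b \<phi>"] that] b[OF that]
      by (auto simp: prob_space abs_le_iff minus_le_iff)
    then have "?L \<in> topspace Q" by (force simp: Q_def abs_le_iff)
    then show "?L \<in> K"
      unfolding K_iff using plus_I scale_I one_I int mono by (simp add: prob_space)
    show "(\<integral>x. \<phi> x \<partial>M) = ?L \<phi>" if "\<phi> \<in> I" for \<phi> using that by simp
  qed
  show ?thesis
    unfolding compact_space_alt
  proof (intro allI impI)
    fix \<U> assume \<U>: "(\<forall>U\<in>\<U>. openin (weak_star_topology X) U) \<and> topspace (weak_star_topology X) \<subseteq> \<Union>\<U>"
    then have "T ` K \<subseteq> \<Union>\<U>" using T(1) by (auto simp: topspace_weak_star)
    then obtain \<F> where \<F>: "finite \<F>" "\<F> \<subseteq> \<U>" "T ` K \<subseteq> \<Union>\<F>"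
      using compactinD[OF compT, of \<U>] \<U> by auto
    have "M \<in> \<Union>\<F>" if M: "M \<in> prob_measures X" for M
    proof -
      obtain L where L: "L \<in> K" "\<forall>\<phi>\<in>I. (\<integral>x. \<phi> x \<partial>M) = L \<phi>" using repr[OF M] by blast
      then obtain V where V: "V \<in> \<F>" "T L \<in> V" using \<F>(3) by blast
      moreover have "M \<in> V"
      proof (rule openin_weak_star_same_integrals[OF _ V(2) M])
        show "openin (weak_star_topology X) V" using \<U> V(1) \<F>(2) by auto
        show "(\<integral>x. \<phi> x \<partial>M) = (\<integral>x. \<phi> x \<partial>T L)" if "continuous_on X \<phi>" for \<phi> :: "'a \<Rightarrow> real"
          using L T(2)[OF L(1)] that by (simp add: I_def)
      qed
      ultimately show ?thesis by blast
    qed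
    then show "\<exists>\<F>. finite \<F> \<and> \<F> \<subseteq> \<U> \<and> topspace (weak_star_topology X) \<subseteq> \<Union>\<F>"
      using \<F> by (intro exI[of _ \<F>]) (auto simp: topspace_weak_star)
  qed
qed

text \<open>A Lebesgue number without a metric: each measure gets a ball whose double lies in a
  member of the cover, finitely many of these balls suffice, and their pooled test functions with
  the least radius serve all measures. This reduces arbitrary covers to finitely many
  integrals.\<close>

lemma weak_star_Lebesgue_number:
  assumes X: "compact X" and \<W>: "\<W> \<in> open_covers (weak_star_topology X)"
  shows "\<exists>\<Phi> e. finite \<Phi> \<and> (\<forall>\<phi>\<in>\<Phi>. continuous_on X \<phi>) \<and> 0 < e \<and>
    (\<forall>M\<in>prob_measures X. \<exists>W\<in>\<W>. weak_ball X \<Phi> e M \<subseteq> W)"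
proof -
  have "\<forall>M\<in>prob_measures X. \<exists>p. finite (fst p) \<and> (\<forall>\<phi>\<in>fst p. continuous_on X \<phi>) \<and> 0 < snd p
      \<and> (\<exists>W\<in>\<W>. weak_ball X (fst p) (2 * snd p) M \<subseteq> W)"
  proof
    fix M assume M: "M \<in> prob_measures X"
    obtain W where W: "W \<in> \<W>" "M \<in> W" "openin (weak_star_topology X) W"
      using \<W> M by (auto simp: open_covers_def topspace_weak_star)
    obtain \<Phi> e where "finite \<Phi>" "\<And>\<phi>. \<phi> \<in> \<Phi> \<Longrightarrow> continuous_on X \<phi>" "0 < e" "weak_ball X \<Phi> e M \<subseteq> W"
      using openin_weak_star_contains_weak_ball[OF W(3,2)] by metis
    then show "\<exists>p. finite (fst p) \<and> (\<forall>\<phi>\<in>fst p. continuous_on X \<phi>) \<and> 0 < snd p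
        \<and> (\<exists>W\<in>\<W>. weak_ball X (fst p) (2 * snd p) M \<subseteq> W)"
      using W(1) by (intro exI[of _ "(\<Phi>, e/2)"]) auto
  qed
  from bchoice[OF this] obtain p where p: "\<forall>M\<in>prob_measures X. finite (fst (p M)) \<and> (\<forall>\<phi>\<in>fst (p M). continuous_on X \<phi>)
      \<and> 0 < snd (p M) \<and> (\<exists>W\<in>\<W>. weak_ball X (fst (p M)) (2 * snd (p M)) M \<subseteq> W)"
    by blast
  define \<Phi> e where "\<Phi> = fst \<circ> p" and "e = snd \<circ> p"
  have N: "\<And>M. M \<in> prob_measures X \<Longrightarrow> finite (\<Phi> M)"
      "\<And>M \<phi>. M \<in> prob_measures X \<Longrightarrow> \<phi> \<in> \<Phi> M \<Longrightarrow> continuous_on X \<phi>"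
      "\<And>M. M \<in> prob_measures X \<Longrightarrow> 0 < e M"
      "\<And>M. M \<in> prob_measures X \<Longrightarrow> \<exists>W\<in>\<W>. weak_ball X (\<Phi> M) (2 * e M) M \<subseteq> W"
    using p by (simp_all add: \<Phi>_def e_def)
  have self: "M \<in> weak_ball X (\<Phi> M) (e M) M" if "M \<in> prob_measures X" for M
    using N(3) that by (auto simp: weak_ball_def)
  define \<B> where "\<B> = (\<lambda>M. weak_ball X (\<Phi> M) (e M) M) ` prob_measures X"
  have "openin (weak_star_topology X) (weak_ball X (\<Phi> M) (e M) M)" if "M \<in> prob_measures X" for M
    using N(1,2)[OF that] by (rule openin_weak_ball)
  then have "(\<forall>U\<in>\<B>. openin (weak_star_topology X) U) \<and> topspace (weak_star_topology X) \<subseteq> \<Union>\<B>"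
    using self unfolding \<B>_def topspace_weak_star by blast
  then obtain \<F> where \<F>: "finite \<F>" "\<F> \<subseteq> \<B>" "topspace (weak_star_topology X) \<subseteq> \<Union>\<F>"
    using compact_space_weak_star[OF X] unfolding compact_space_alt by meson
  then obtain C where "finite C" "C \<subseteq> prob_measures X" "\<F> = (\<lambda>M. weak_ball X (\<Phi> M) (e M) M) ` C"
    unfolding \<B>_def using finite_subset_image by meson
  with \<F> have C: "finite C" "C \<subseteq> prob_measures X"
      "prob_measures X \<subseteq> (\<Union>M\<in>C. weak_ball X (\<Phi> M) (e M) M)"
    by (simp_all add: topspace_weak_star)
  \<comment> \<open>\<open>insert 1\<close> keeps the minimum meaningful when \<open>C\<close> is
    empty, as happens for empty \<open>X\<close>.\<close>
  define d where "d = Min (insert 1 (e ` C))"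
  have d: "0 < d" "\<And>M. M \<in> C \<Longrightarrow> d \<le> e M"
    using C N(3) by (auto simp: d_def)
  show ?thesis
  proof (intro exI[of _ "\<Union>M\<in>C. \<Phi> M"] exI[of _ d] conjI ballI)
    show "finite (\<Union>M\<in>C. \<Phi> M)" using C N(1) by auto
    show "continuous_on X \<phi>" if "\<phi> \<in> (\<Union>M\<in>C. \<Phi> M)" for \<phi> using that C N(2) by auto
    show "0 < d" by (rule d)
    fix M assume "M \<in> prob_measures X"
    then obtain M0 where M0: "M0 \<in> C" "M \<in> weak_ball X (\<Phi> M0) (e M0) M0" using C(3) by blast
    have "weak_ball X (\<Union>M\<in>C. \<Phi> M) d M \<subseteq> weak_ball X (\<Phi> M0) (2 * e M0) M0"
    proof
      fix M' assume M': "M' \<in> weak_ball X (\<Union>M\<in>C. \<Phi> M) d M"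
      have "\<bar>(\<integral>x. \<phi> x \<partial>M') - (\<integral>x. \<phi> x \<partial>M0)\<bar> < 2 * e M0" if "\<phi> \<in> \<Phi> M0" for \<phi>
      proof -
        have "\<bar>(\<integral>x. \<phi> x \<partial>M') - (\<integral>x. \<phi> x \<partial>M)\<bar> < d" using M' M0(1) that by (auto simp: weak_ball_def)
        moreover have "\<bar>(\<integral>x. \<phi> x \<partial>M) - (\<integral>x. \<phi> x \<partial>M0)\<bar> < e M0" using M0(2) that by (auto simp: weak_ball_def)
        ultimately show ?thesis using d(2)[OF M0(1)] by linarith
      qed
      then show "M' \<in> weak_ball X (\<Phi> M0) (2 * e M0) M0" using M' by (auto simp: weak_ball_def)
    qed
    then show "\<exists>W\<in>\<W>. weak_ball X (\<Union>M\<in>C. \<Phi> M) d M \<subseteq> W"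
      using N(4)[of M0] M0(1) C(2) by blast
  qed
qed

text \<open>The passage back from test functions to a cover: balls of half the tolerance, finitely
  many by compactness. A gap between two integrals then forbids the measures to share a
  member.\<close>

lemma weak_star_small_cover:
  fixes X :: "'a::metric_space set" and \<Phi> :: "('a \<Rightarrow> real) set"
  assumes X: "compact X" and \<Phi>: "finite \<Phi>" "\<And>\<phi>. \<phi> \<in> \<Phi> \<Longrightarrow> continuous_on X \<phi>" and e: "0 < e"
  shows "\<exists>\<W>\<in>open_covers (weak_star_topology X).
    \<forall>W\<in>\<W>. \<forall>M\<in>W. \<forall>M'\<in>W. \<forall>\<phi>\<in>\<Phi>. \<bar>(\<integral>x. \<phi> x \<partial>M) - (\<integral>x. \<phi> x \<partial>M')\<bar> < e"
proof -
  define \<B> where "\<B> = weak_ball X \<Phi> (e/2) ` prob_measures X"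
  have "M \<in> weak_ball X \<Phi> (e/2) M" if "M \<in> prob_measures X" for M
    using that e by (simp add: weak_ball_def)
  then have \<B>: "(\<forall>U\<in>\<B>. openin (weak_star_topology X) U) \<and> topspace (weak_star_topology X) \<subseteq> \<Union>\<B>"
    using openin_weak_ball[OF \<Phi>] unfolding \<B>_def topspace_weak_star by blast
  then obtain \<F> where \<F>: "finite \<F>" "\<F> \<subseteq> \<B>" "topspace (weak_star_topology X) \<subseteq> \<Union>\<F>"
    using compact_space_weak_star[OF X] unfolding compact_space_alt by meson
  show ?thesis
  proof (intro bexI[of _ \<F>] ballI)
    show "\<F> \<in> open_covers (weak_star_topology X)"
      using \<F> \<B> openin_subset unfolding open_covers_def by blast
    fix W M M' \<phi> assume "W \<in> \<F>" "M \<in> W" "M' \<in> W" "\<phi> \<in> \<Phi>"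
    then obtain M0 where "M \<in> weak_ball X \<Phi> (e/2) M0" "M' \<in> weak_ball X \<Phi> (e/2) M0"
      using \<F>(2) by (auto simp: \<B>_def)
    then have "\<bar>(\<integral>x. \<phi> x \<partial>M) - (\<integral>x. \<phi> x \<partial>M0)\<bar> < e/2" "\<bar>(\<integral>x. \<phi> x \<partial>M') - (\<integral>x. \<phi> x \<partial>M0)\<bar> < e/2"
      using \<open>\<phi> \<in> \<Phi>\<close> by (auto simp: weak_ball_def)
    then show "\<bar>(\<integral>x. \<phi> x \<partial>M) - (\<integral>x. \<phi> x \<partial>M')\<bar> < e" by linarith
  qed
qed

subsection \<open>Joins of covers and push-forwards\<close>

text \<open>Itinerary form of the join, in which both counting arguments use it: a member prescribes
  one cell of \<open>\<U>\<close> at each of the sampled times \<open>a i\<close>.\<close>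

lemma join_cover_eq:
  "join_cover T g a n \<U> =
    {{x \<in> topspace T. \<forall>i<n. comp_seq g (a i) x \<in> U i} | U. \<forall>i<n. U i \<in> \<U>}" (is "_ = ?R")
proof (intro equalityI subsetI)
  fix A assume "A \<in> join_cover T g a n \<U>"
  then obtain V where A: "A = topspace T \<inter> (\<Inter>i\<in>{..<n}. V i)"
      and "\<forall>i<n. V i \<in> preimage_cover T (comp_seq g (a i)) \<U>"
    unfolding join_cover_def by blast
  then have "\<forall>i\<in>{..<n}. \<exists>U. U \<in> \<U> \<and> V i = {x \<in> topspace T. comp_seq g (a i) x \<in> U}"
    unfolding preimage_cover_def by blast
  from bchoice[OF this] obtain U where U: "\<And>i. i < n \<Longrightarrow> U i \<in> \<U>"
      "\<And>i. i < n \<Longrightarrow> V i = {x \<in> topspace T. comp_seq g (a i) x \<in> U i}"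
    by auto
  have "A = {x \<in> topspace T. \<forall>i<n. comp_seq g (a i) x \<in> U i}" using A U(2) by auto
  then show "A \<in> ?R" using U(1) by blast
next
  fix A assume "A \<in> ?R"
  then obtain U where U: "A = {x \<in> topspace T. \<forall>i<n. comp_seq g (a i) x \<in> U i}" "\<forall>i<n. U i \<in> \<U>"
    by blast
  then have "A = topspace T \<inter> (\<Inter>i\<in>{..<n}. {x \<in> topspace T. comp_seq g (a i) x \<in> U i})" by auto
  moreover have "\<forall>i<n. {x \<in> topspace T. comp_seq g (a i) x \<in> U i} \<in> preimage_cover T (comp_seq g (a i)) \<U>"
    using U(2) unfolding preimage_cover_def by blast
  ultimately show "A \<in> join_cover T g a n \<U>"
    unfolding join_cover_def by (intro CollectI exI[of _ "\<lambda>i. {x \<in> topspace T. comp_seq g (a i) x \<in> U i}"]) simp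
qed

lemma finite_join_cover:
  assumes "finite \<U>"
  shows "finite (join_cover T g a n \<U>)"
proof (rule finite_subset)
  show "join_cover T g a n \<U> \<subseteq>
      (\<lambda>U. {x \<in> topspace T. \<forall>i<n. comp_seq g (a i) x \<in> U i}) ` ({..<n} \<rightarrow>\<^sub>E \<U>)"
  proof
    fix A assume "A \<in> join_cover T g a n \<U>"
    then obtain U where "A = {x \<in> topspace T. \<forall>i<n. comp_seq g (a i) x \<in> U i}" "\<forall>i<n. U i \<in> \<U>"
      unfolding join_cover_eq by blast
    then show "A \<in> (\<lambda>U. {x \<in> topspace T. \<forall>i<n. comp_seq g (a i) x \<in> U i}) ` ({..<n} \<rightarrow>\<^sub>E \<U>)"
      by (intro image_eqI[of _ _ "restrict U {..<n}"]) auto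
  qed
qed (use assms in \<open>simp add: finite_PiE\<close>)

lemma join_cover_subset: "V \<in> join_cover T g a n \<U> \<Longrightarrow> V \<subseteq> topspace T"
  unfolding join_cover_eq by auto

lemma Union_join_cover:
  assumes "\<U> \<in> open_covers T" "\<And>i. comp_seq g (a i) ` topspace T \<subseteq> topspace T"
  shows "\<Union>(join_cover T g a n \<U>) = topspace T"
proof (intro equalityI subsetI)
  fix x assume x: "x \<in> topspace T"
  have "\<Union>\<U> = topspace T" using assms(1) by (simp add: open_covers_def)
  then have "\<forall>i. \<exists>U. U \<in> \<U> \<and> comp_seq g (a i) x \<in> U"
    using assms(2) x by blast
  from choice[OF this] obtain U where "\<And>i. U i \<in> \<U>" "\<And>i. comp_seq g (a i) x \<in> U i" by blast
  then have "{x \<in> topspace T. \<forall>i<n. comp_seq g (a i) x \<in> U i} \<in> join_cover T g a n \<U>"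
    unfolding join_cover_eq by blast
  then show "x \<in> \<Union>(join_cover T g a n \<U>)" using x \<open>\<And>i. comp_seq g (a i) x \<in> U i\<close> by blast
qed (use join_cover_subset in blast)

text \<open>In the applications \<open>S\<close> is a set of codes or of centres. The pieces
  \<open>B s\<close> may be arbitrary sets: the subcover consists of one member of
  \<open>\<V>\<close> around each of them.\<close>

lemma min_subcover_le:
  assumes S: "finite S" and cov: "\<And>x. x \<in> topspace T \<Longrightarrow> \<exists>s\<in>S. x \<in> B s"
    and sub: "\<And>s. s \<in> S \<Longrightarrow> \<exists>V\<in>\<V>. B s \<subseteq> V" and top: "\<And>V. V \<in> \<V> \<Longrightarrow> V \<subseteq> topspace T"
  shows "min_subcover T \<V> \<le> card S"
proof -
  from sub have "\<forall>s\<in>S. \<exists>V. V \<in> \<V> \<and> B s \<subseteq> V" by blast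
  from bchoice[OF this] obtain v where v: "\<forall>s\<in>S. v s \<in> \<V> \<and> B s \<subseteq> v s" by blast
  have "min_subcover T \<V> \<le> card (v ` S)"
    unfolding min_subcover_def
  proof (intro Least_le exI conjI)
    show "v ` S \<subseteq> \<V>" using v by blast
    show "\<Union>(v ` S) = topspace T"
    proof (intro equalityI subsetI)
      fix x assume "x \<in> \<Union>(v ` S)"
      then show "x \<in> topspace T" using v top by auto
    next
      fix x assume "x \<in> topspace T"
      then obtain s where "s \<in> S" "x \<in> B s" using cov by blast
      then show "x \<in> \<Union>(v ` S)" using v by auto
    qed
    show "finite (v ` S)" using S by blast
  qed (rule refl)
  also have "\<dots> \<le> card S" using S by (rule card_image_le)
  finally show ?thesis .
qed

lemma min_subcover_attained:
  assumes "finite \<V>" "\<Union>\<V> = topspace T"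
  obtains \<V>' where "\<V>' \<subseteq> \<V>" "\<Union>\<V>' = topspace T" "finite \<V>'" "card \<V>' = min_subcover T \<V>"
proof -
  have "\<exists>k. \<exists>\<V>'. \<V>' \<subseteq> \<V> \<and> \<Union>\<V>' = topspace T \<and> finite \<V>' \<and> card \<V>' = k" using assms by blast
  from LeastI_ex[OF this] show ?thesis using that unfolding min_subcover_def by blast
qed

text \<open>Each member of a subcover can account for only one point of \<open>E\<close>.\<close>

lemma card_le_min_subcover:
  assumes \<V>: "finite \<V>" "\<Union>\<V> = topspace T" and E: "E \<subseteq> topspace T"
    and one: "\<And>V x y. V \<in> \<V> \<Longrightarrow> x \<in> E \<Longrightarrow> y \<in> E \<Longrightarrow> x \<in> V \<Longrightarrow> y \<in> V \<Longrightarrow> x = y"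
  shows "card E \<le> min_subcover T \<V>"
proof -
  obtain \<V>' where \<V>': "\<V>' \<subseteq> \<V>" "\<Union>\<V>' = topspace T" "finite \<V>'" "card \<V>' = min_subcover T \<V>"
    using min_subcover_attained[OF \<V>] by blast
  then have "\<forall>x\<in>E. \<exists>V. V \<in> \<V>' \<and> x \<in> V" using E by blast
  from bchoice[OF this] obtain v where v: "\<forall>x\<in>E. v x \<in> \<V>' \<and> x \<in> v x" by blast
  have "inj_on v E"
  proof (rule inj_onI)
    fix x y assume "x \<in> E" "y \<in> E" "v x = v y"
    then show "x = y" using one[of "v x" x y] v \<V>'(1) by auto
  qed
  moreover have "v ` E \<subseteq> \<V>'" using v by blast
  ultimately show ?thesis using card_inj_on_le[of v E \<V>'] \<V>'(3,4) by simp
qed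

section \<open>Iterates of the base maps and of their push-forwards\<close>

lemma continuous_on_comp_seq:
  assumes "\<And>n. continuous_on X (f n)" "\<And>n. f n ` X \<subseteq> X"
  shows "comp_seq f m ` X \<subseteq> X" "continuous_on X (comp_seq f m)"
proof (induction m)
  case (Suc m)
  show 1: "comp_seq f (Suc m) ` X \<subseteq> X" using Suc(1) assms(2)[of m] by (auto simp: image_comp[symmetric])
  show "continuous_on X (comp_seq f (Suc m))"
    unfolding comp_seq.simps using Suc(2) continuous_on_subset[OF assms(1) Suc(1)]
    by (rule continuous_on_compose)
qed auto

lemma push_forward_prob_measures:
  fixes h :: "'a::metric_space \<Rightarrow> 'a" and \<phi> :: "'a \<Rightarrow> real"
  assumes M: "M \<in> prob_measures X" and h: "continuous_on X h" "h ` X \<subseteq> X"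
  shows "push_forward X h M \<in> prob_measures X"
    "continuous_on X \<phi> \<Longrightarrow> (\<integral>x. \<phi> x \<partial>push_forward X h M) = (\<integral>x. \<phi> (h x) \<partial>M)"
proof -
  interpret prob_space M using M by (simp add: prob_measures_def)
  have "h \<in> measurable (restrict_space borel X) borel"
    using h(1) by (rule borel_measurable_continuous_on_restrict)
  then have "h \<in> measurable (restrict_space borel X) (restrict_space borel X)"
    using h(2) by (intro measurable_restrict_space2) (auto simp: space_restrict_space)
  moreover have "sets M = sets (restrict_space borel X)" using M by (simp add: prob_measures_def)
  ultimately have m: "h \<in> measurable M (restrict_space borel X)"
    using measurable_cong_sets[OF _ refl] by blast
  show "push_forward X h M \<in> prob_measures X"
    using prob_space_distr[OF m] by (simp add: prob_measures_def push_forward_def)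
  show "(\<integral>x. \<phi> x \<partial>push_forward X h M) = (\<integral>x. \<phi> (h x) \<partial>M)" if "continuous_on X \<phi>"
    unfolding push_forward_def
    using m borel_measurable_continuous_on_restrict[OF that] by (rule integral_distr)
qed

lemma comp_seq_push_forward:
  fixes f :: "nat \<Rightarrow> 'a::metric_space \<Rightarrow> 'a" and \<phi> :: "'a \<Rightarrow> real"
  assumes f: "\<And>n. continuous_on X (f n)" "\<And>n. f n ` X \<subseteq> X" and M: "M \<in> prob_measures X"
  shows "comp_seq (\<lambda>n. push_forward X (f n)) m M \<in> prob_measures X"
    "continuous_on X \<phi> \<Longrightarrow>
      (\<integral>x. \<phi> x \<partial>comp_seq (\<lambda>n. push_forward X (f n)) m M) = (\<integral>x. \<phi> (comp_seq f m x) \<partial>M)"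
proof (induction m arbitrary: \<phi>)
  case (Suc m)
  {
    case 1
    show ?case using push_forward_prob_measures(1)[OF Suc(1) f] by simp
  next
    case 2
    have "continuous_on X (\<lambda>x. \<phi> (f m x))"
      using continuous_on_compose2[OF 2 f] .
    then show ?case using push_forward_prob_measures(2)[OF Suc(1) f 2] Suc(2) by simp
  }
qed (use M in auto)

subsection \<open>Positive entropy\<close>

lemma finite_net:
  fixes X :: "'a::metric_space set"
  assumes "compact X" "0 < e"
  obtains Z where "finite Z" "Z \<subseteq> X" "\<And>x. x \<in> X \<Longrightarrow> \<exists>z\<in>Z. dist x z < e"
proof -
  have "X \<subseteq> (\<Union>z\<in>X. ball z e)" using assms(2) by auto
  then obtain Z where Z: "Z \<subseteq> X" "finite Z" "X \<subseteq> (\<Union>z\<in>Z. ball z e)"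
    by (rule compactE_image[OF assms(1) open_ball])
  have "\<exists>z\<in>Z. dist x z < e" if "x \<in> X" for x
  proof -
    obtain z where "z \<in> Z" "x \<in> ball z e" using Z(3) \<open>x \<in> X\<close> by blast
    then show ?thesis by (auto simp: dist_commute)
  qed
  then show ?thesis using that[OF Z(2,1)] by blast
qed

text \<open>Since the weights are powers of two, subset sums are determined by the subset.  A test
  function which is 1 on a ball and 0 off a slightly larger one picks out such a subset as soon as
  none of the \<open>2 k\<close> points lies in the annulus in between, and among \<open>2 k + 1\<close> disjoint annuli
  around the same centre one is free.\<close>

lemma weighted_tuples_distinguished:
  fixes X :: "'a::metric_space set"
  assumes X: "compact X" and \<delta>: "0 < \<delta>"
  shows "\<exists>\<Phi> :: ('a \<Rightarrow> real) set. finite \<Phi> \<and> (\<forall>\<phi>\<in>\<Phi>. continuous_on X \<phi>) \<and>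
    (\<forall>u v. (\<forall>j<k. u j \<in> X \<and> v j \<in> X) \<longrightarrow> (\<exists>j<k. \<delta> \<le> dist (u j) (v j)) \<longrightarrow>
      (\<exists>\<phi>\<in>\<Phi>. 1 \<le> \<bar>(\<Sum>j<k. 2^j * \<phi> (u j)) - (\<Sum>j<k. 2^j * \<phi> (v j))\<bar>))"
proof -
  \<comment> \<open>The largest index is \<open>l = 2 * k + 1\<close>, and its bump dies out at
    distance \<open>(l + 1) * \<eta>\<close> from the centre \<open>z\<close>. As \<open>z\<close>
    is only within \<open>\<eta>\<close> of \<open>u j\<close>, reaching \<open>v j\<close> takes
    one more \<open>\<eta>\<close>, in all \<open>(2 * k + 3) * \<eta> = \<delta>\<close>.\<close>
  define \<eta> where "\<eta> = \<delta> / (2 * real k + 3)"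
  have \<eta>: "0 < \<eta>" "(2 * real k + 3) * \<eta> = \<delta>" using \<delta> by (auto simp: \<eta>_def)
  obtain Z where Z: "finite Z" "Z \<subseteq> X" "\<And>x. x \<in> X \<Longrightarrow> \<exists>z\<in>Z. dist x z < \<eta>"
    using finite_net[OF X \<eta>(1)] by blast
  \<comment> \<open>Equal to 1 up to distance \<open>l * \<eta>\<close> from \<open>z\<close> and to
    0 from distance \<open>(l + 1) * \<eta>\<close> on.\<close>
  define bump where "bump = (\<lambda>(z::'a, l::nat) x. min 1 (max 0 (real l + 1 - dist x z / \<eta>)))"
  show ?thesis
  proof (intro exI[of _ "bump ` (Z \<times> {1..2 * k + 1})"] conjI ballI allI impI)
    show "finite (bump ` (Z \<times> {1..2 * k + 1}))" using Z by auto
    show "continuous_on X \<phi>" if \<phi>: "\<phi> \<in> bump ` (Z \<times> {1..2 * k + 1})" for \<phi>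
      using \<phi> \<eta>(1) by (auto simp: bump_def intro!: continuous_intros)
    fix u v :: "nat \<Rightarrow> 'a"
    assume uv: "\<forall>j<k. u j \<in> X \<and> v j \<in> X" and "\<exists>j<k. \<delta> \<le> dist (u j) (v j)"
    then obtain j where j: "j < k" "\<delta> \<le> dist (u j) (v j)" by blast
    then obtain z where z: "z \<in> Z" "dist (u j) z < \<eta>" using Z(3) uv by blast
    define P where "P = u ` {..<k} \<union> v ` {..<k}"
    have "card P \<le> 2 * k"
      using card_Un_le[of "u ` {..<k}" "v ` {..<k}"] card_image_le[of "{..<k}" u] card_image_le[of "{..<k}" v]
      by (simp add: P_def)
    moreover have "finite P" by (simp add: P_def)
    \<comment> \<open>Pigeonhole: the rounded-down distance in units of \<open>\<eta>\<close> names
      the annulus of a point, and the at most \<open>2 * k\<close> points cannot occupy all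
      \<open>2 * k + 1\<close> annuli.\<close>
    ultimately have "card ((\<lambda>p. nat \<lfloor>dist p z / \<eta>\<rfloor>) ` P) < card {1..2 * k + 1}"
      using card_image_le[of P "\<lambda>p. nat \<lfloor>dist p z / \<eta>\<rfloor>"] by simp
    then have "\<not> {1..2 * k + 1} \<subseteq> (\<lambda>p. nat \<lfloor>dist p z / \<eta>\<rfloor>) ` P"
      using card_mono[OF finite_imageI[OF \<open>finite P\<close>]] by (meson not_less)
    then obtain l where l: "l \<in> {1..2 * k + 1}" "\<And>p. p \<in> P \<Longrightarrow> nat \<lfloor>dist p z / \<eta>\<rfloor> \<noteq> l" by blast
    define \<phi> where "\<phi> = bump (z, l)"
    have "\<phi> p = 0 \<or> \<phi> p = 1" if "p \<in> P" for p
    proof -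
      have "\<not> (real l < dist p z / \<eta> \<and> dist p z / \<eta> < real l + 1)"
      proof
        assume "real l < dist p z / \<eta> \<and> dist p z / \<eta> < real l + 1"
        then have "\<lfloor>dist p z / \<eta>\<rfloor> = int l" by (intro floor_unique) auto
        then show False using l(2)[OF that] by simp
      qed
      then show ?thesis by (auto simp: \<phi>_def bump_def)
    qed
    \<comment> \<open>On the points in question the bump is 0 or 1, so the weighted sum is the
      binary code of a set of indices. Different sets have different natural numbers as codes, hence
      a gap of at least 1.\<close>
    then have sum: "(\<Sum>j<k. 2^j * \<phi> (w j)) = real (set_encode {j. j < k \<and> \<phi> (w j) = 1})"
      if "w ` {..<k} \<subseteq> P" for w
    proof -
      have "(\<Sum>j<k. 2^j * \<phi> (w j)) = (\<Sum>j<k. if \<phi> (w j) = 1 then 2^j else 0)"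
        using that \<open>\<And>p. p \<in> P \<Longrightarrow> \<phi> p = 0 \<or> \<phi> p = 1\<close> by (intro sum.cong) (auto simp: image_subset_iff)
      also have "\<dots> = (\<Sum>j\<in>{j. j < k \<and> \<phi> (w j) = 1}. 2^j)"
        by (simp add: sum.If_cases Int_def lessThan_def)
      finally show ?thesis by (simp add: set_encode_def)
    qed
    have "dist (u j) z / \<eta> < 1" using z(2) \<eta>(1) by simp
    then have "\<phi> (u j) = 1" using l(1) by (auto simp: \<phi>_def bump_def)
    moreover have "\<phi> (v j) = 0"
    proof -
      have "(real l + 2) * \<eta> \<le> (2 * real k + 3) * \<eta>" using l(1) \<eta>(1) by (intro mult_right_mono) auto
      also have "\<dots> \<le> dist (u j) (v j)" using j \<eta> by simp
      also have "\<dots> \<le> dist (u j) z + dist (v j) z" by (rule dist_triangle2)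
      finally have "(real l + 1) * \<eta> \<le> dist (v j) z" using z(2) by (simp add: algebra_simps)
      then have "real l + 1 \<le> dist (v j) z / \<eta>" using \<eta>(1) by (simp add: field_simps)
      then show ?thesis by (simp add: \<phi>_def bump_def)
    qed
    ultimately have "j \<in> {j. j < k \<and> \<phi> (u j) = 1}" "j \<notin> {j. j < k \<and> \<phi> (v j) = 1}"
      using j(1) by auto
    then have "{j. j < k \<and> \<phi> (u j) = 1} \<noteq> {j. j < k \<and> \<phi> (v j) = 1}" by blast
    then have "set_encode {j. j < k \<and> \<phi> (u j) = 1} \<noteq> set_encode {j. j < k \<and> \<phi> (v j) = 1}"
      by (subst set_encode_eq) auto
    then have "1 \<le> \<bar>(\<Sum>j<k. 2^j * \<phi> (u j)) - (\<Sum>j<k. 2^j * \<phi> (v j))\<bar>"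
      by (subst (1 2) sum) (auto simp: P_def)
    then show "\<exists>\<phi>\<in>bump ` (Z \<times> {1..2 * k + 1}).
        1 \<le> \<bar>(\<Sum>j<k. 2^j * \<phi> (u j)) - (\<Sum>j<k. 2^j * \<phi> (v j))\<bar>"
      using z(1) l(1) unfolding \<phi>_def by blast
  qed
qed

lemma dyadic_weights_pmf:
  assumes "0 < k"
  obtains \<pi> :: "nat pmf"
  where "\<And>g :: nat \<Rightarrow> real. (\<integral>j. g j \<partial>measure_pmf \<pi>) = (\<Sum>j<k. 2^j * g j) / (2^k - 1)"
proof -
  define w :: "nat \<Rightarrow> real" where "w = (\<lambda>j. if j < k then 2^j / (2^k - 1) else 0)"
  have pos: "(0::real) < 2^k - 1" using assms by simp
  have w: "0 \<le> w j" for j using pos by (simp add: w_def)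
  have "(\<Sum>j<k. w j) = (\<Sum>j<k. 2^j) / (2^k - 1)" by (simp add: w_def sum_divide_distrib)
  also have "(\<Sum>j<k. 2^j) = (2^k - 1 :: real)" by (induction k) auto
  finally have "(\<Sum>j<k. w j) = 1" using pos by simp
  moreover have "(\<integral>\<^sup>+ j. ennreal (w j) \<partial>count_space UNIV) = (\<Sum>j<k. ennreal (w j))"
    by (intro nn_integral_count_space') (auto simp: w_def)
  ultimately have 1: "(\<integral>\<^sup>+ j. ennreal (w j) \<partial>count_space UNIV) = 1"
    using w by (simp add: sum_ennreal)
  have pmf: "pmf (embed_pmf w) j = w j" for j using w 1 by (rule pmf_embed_pmf)
  show ?thesis
  proof (rule that)
    fix g :: "nat \<Rightarrow> real"
    have "(\<integral>j. g j \<partial>measure_pmf (embed_pmf w)) = (\<Sum>j<k. g j * pmf (embed_pmf w) j)"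
    proof (rule integral_measure_pmf_real)
      fix j assume "j \<in> set_pmf (embed_pmf w)"
      then have "w j \<noteq> 0" by (simp add: set_pmf_iff pmf)
      then show "j \<in> {..<k}" by (simp add: w_def split: if_splits)
    qed simp
    also have "\<dots> = (\<Sum>j<k. g j * w j)" by (simp only: pmf)
    finally show "(\<integral>j. g j \<partial>measure_pmf (embed_pmf w)) = (\<Sum>j<k. 2^j * g j) / (2^k - 1)"
      by (simp add: w_def sum_divide_distrib mult.commute)
  qed
qed

text \<open>Greedy choice. If no further point could be added, the points staying
  \<open>\<delta>\<close>-close to some member of \<open>E\<close> at all sampled times would
  exhaust \<open>X\<close>; by the Lebesgue number each such set lies in one member of the join, so
  \<open>card E\<close> members would already cover.\<close>

lemma exists_separated_set:
  fixes X :: "'a::metric_space set"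
  assumes f: "\<And>n. continuous_on X (f n)" "\<And>n. f n ` X \<subseteq> X"
    and \<delta>: "0 < \<delta>" "\<And>x. x \<in> X \<Longrightarrow> \<exists>U\<in>\<U>. X \<inter> ball x \<delta> \<subseteq> U"
    and "m \<le> min_subcover (top_of_set X) (join_cover (top_of_set X) f a n \<U>)"
  shows "\<exists>E\<subseteq>X. finite E \<and> card E = m \<and>
    (\<forall>x\<in>E. \<forall>y\<in>E. x \<noteq> y \<longrightarrow> (\<exists>i<n. \<delta> \<le> dist (comp_seq f (a i) x) (comp_seq f (a i) y)))"
proof -
  have inv: "comp_seq f j x \<in> X" if "x \<in> X" for j x
    using continuous_on_comp_seq(1)[of X f j] f that by (simp add: image_subset_iff)
  show ?thesis using assms(5)
  proof (induction m)
    case 0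
    then show ?case by (intro exI[of _ "{}"]) simp
  next
    case (Suc m)
    from Suc.IH[OF Suc_leD[OF Suc.prems]] obtain E where E: "E \<subseteq> X" "finite E" "card E = m"
        "\<forall>x\<in>E. \<forall>y\<in>E. x \<noteq> y \<longrightarrow> (\<exists>i<n. \<delta> \<le> dist (comp_seq f (a i) x) (comp_seq f (a i) y))"
      by blast
    have "\<exists>x\<in>X. \<forall>y\<in>E. \<exists>i<n. \<delta> \<le> dist (comp_seq f (a i) x) (comp_seq f (a i) y)"
    proof (rule ccontr)
      assume no: "\<not> ?thesis"
      have "min_subcover (top_of_set X) (join_cover (top_of_set X) f a n \<U>) \<le> card E"
      proof (rule min_subcover_le)
        fix x assume "x \<in> topspace (top_of_set X)"
        then have x: "x \<in> X" by simp
        with no obtain y where "y \<in> E" "\<not> (\<exists>i<n. \<delta> \<le> dist (comp_seq f (a i) x) (comp_seq f (a i) y))"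
          by blast
        then show "\<exists>y\<in>E. x \<in> {x \<in> X. \<forall>i<n. dist (comp_seq f (a i) x) (comp_seq f (a i) y) < \<delta>}"
          using x by (intro bexI[of _ y]) (simp_all add: not_le)
      next
        fix y assume "y \<in> E"
        then have "comp_seq f (a i) y \<in> X" for i using E(1) inv by auto
        then have "\<forall>i. \<exists>U. U \<in> \<U> \<and> X \<inter> ball (comp_seq f (a i) y) \<delta> \<subseteq> U" using \<delta>(2) by blast
        from choice[OF this] obtain U where U: "\<And>i. U i \<in> \<U>" "\<And>i. X \<inter> ball (comp_seq f (a i) y) \<delta> \<subseteq> U i"
          by blast
        have "comp_seq f (a i) x \<in> U i"
          if "x \<in> X" "dist (comp_seq f (a i) x) (comp_seq f (a i) y) < \<delta>" for x i
        proof -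
          have "comp_seq f (a i) x \<in> X" using that(1) by (rule inv)
          then show ?thesis using U(2)[of i] that(2) by (auto simp: dist_commute)
        qed
        then have "{x \<in> X. \<forall>i<n. dist (comp_seq f (a i) x) (comp_seq f (a i) y) < \<delta>}
            \<subseteq> {x \<in> topspace (top_of_set X). \<forall>i<n. comp_seq f (a i) x \<in> U i}" by auto
        moreover have "{x \<in> topspace (top_of_set X). \<forall>i<n. comp_seq f (a i) x \<in> U i}
            \<in> join_cover (top_of_set X) f a n \<U>"
          unfolding join_cover_eq using U(1) by blast
        ultimately show "\<exists>V\<in>join_cover (top_of_set X) f a n \<U>.
            {x \<in> X. \<forall>i<n. dist (comp_seq f (a i) x) (comp_seq f (a i) y) < \<delta>} \<subseteq> V" by blast
      qed (rule E(2), rule join_cover_subset)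
      then show False using Suc.prems E(3) by simp
    qed
    then obtain x where x: "x \<in> X" "\<forall>y\<in>E. \<exists>i<n. \<delta> \<le> dist (comp_seq f (a i) x) (comp_seq f (a i) y)" by blast
    have "x \<notin> E"
    proof
      assume "x \<in> E"
      then obtain i where "\<delta> \<le> dist (comp_seq f (a i) x) (comp_seq f (a i) x)" using x(2) by blast
      then show False using \<delta>(1) by simp
    qed
    moreover have "\<forall>y\<in>E. \<exists>i<n. \<delta> \<le> dist (comp_seq f (a i) y) (comp_seq f (a i) x)"
      using x(2) by (simp add: dist_commute)
    ultimately show ?case using E x by (intro exI[of _ "insert x E"]) simp
  qed
qed

lemma open_covers_Lebesgue_number:
  fixes X :: "'a::metric_space set"
  assumes "compact X" "\<U> \<in> open_covers (top_of_set X)"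
  shows "\<exists>\<delta>>0. \<forall>x\<in>X. \<exists>U\<in>\<U>. X \<inter> ball x \<delta> \<subseteq> U"
proof -
  define \<G> where "\<G> = {G. open G \<and> X \<inter> G \<in> \<U>}"
  have "X \<subseteq> \<Union>\<G>"
  proof
    fix x assume "x \<in> X"
    then obtain U where U: "U \<in> \<U>" "x \<in> U" "openin (top_of_set X) U"
      using assms(2) by (auto simp: open_covers_def)
    then obtain G where "open G" "U = X \<inter> G" by (auto simp: openin_open)
    then show "x \<in> \<Union>\<G>" using U by (auto simp: \<G>_def)
  qed
  moreover have "open G" if "G \<in> \<G>" for G using that by (simp add: \<G>_def)
  ultimately obtain \<delta> where \<delta>: "0 < \<delta>" "\<And>x. x \<in> X \<Longrightarrow> \<exists>G\<in>\<G>. ball x \<delta> \<subseteq> G"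
    using Heine_Borel_lemma[OF assms(1), of \<G>] by metis
  have "\<exists>U\<in>\<U>. X \<inter> ball x \<delta> \<subseteq> U" if x: "x \<in> X" for x
  proof -
    obtain G where "G \<in> \<G>" "ball x \<delta> \<subseteq> G" using \<delta>(2)[OF x] by blast
    then show ?thesis by (intro bexI[of _ "X \<inter> G"]) (auto simp: \<G>_def)
  qed
  then show ?thesis using \<delta>(1) by blast
qed

text \<open>Two different \<open>k\<close>-tuples from a separated set differ in some coordinate,
  and the points there are \<open>\<delta>\<close>-apart at some sampled time. The test functions
  detect this at that very time, whatever the other coordinates do. The cover is built from
  \<open>\<delta>\<close> and \<open>k\<close> before \<open>n\<close> is introduced.\<close>

lemma min_subcover_power_le:
  fixes X :: "'a::metric_space set"
  assumes X: "compact X" and f: "\<And>n. continuous_on X (f n)" "\<And>n. f n ` X \<subseteq> X"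
    and \<U>: "\<U> \<in> open_covers (top_of_set X)" and k: "0 < k"
  shows "\<exists>\<W>\<in>open_covers (weak_star_topology X). \<forall>n.
    min_subcover (top_of_set X) (join_cover (top_of_set X) f a n \<U>) ^ k
      \<le> min_subcover (weak_star_topology X)
          (join_cover (weak_star_topology X) (\<lambda>n. push_forward X (f n)) a n \<W>)"
proof -
  obtain \<delta> where \<delta>: "0 < \<delta>" "\<And>x. x \<in> X \<Longrightarrow> \<exists>U\<in>\<U>. X \<inter> ball x \<delta> \<subseteq> U"
    using open_covers_Lebesgue_number[OF X \<U>] by blast
  obtain \<Phi> :: "('a \<Rightarrow> real) set" where \<Phi>: "finite \<Phi>" "\<And>\<phi>. \<phi> \<in> \<Phi> \<Longrightarrow> continuous_on X \<phi>"
    and distinguished: "\<forall>u v. (\<forall>j<k. u j \<in> X \<and> v j \<in> X) \<longrightarrow> (\<exists>j<k. \<delta> \<le> dist (u j) (v j)) \<longrightarrow>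
      (\<exists>\<phi>\<in>\<Phi>. 1 \<le> \<bar>(\<Sum>j<k. 2^j * \<phi> (u j)) - (\<Sum>j<k. 2^j * \<phi> (v j))\<bar>)"
    using weighted_tuples_distinguished[OF X \<delta>(1), of k] by blast
  obtain \<pi> :: "nat pmf" where
    \<pi>: "\<And>g :: nat \<Rightarrow> real. (\<integral>j. g j \<partial>measure_pmf \<pi>) = (\<Sum>j<k. 2^j * g j) / (2^k - 1)"
    using dyadic_weights_pmf[OF k] by blast
  have pos: "(0::real) < 2^k - 1" using k by simp
  then have pos': "0 < 1 / (2^k - 1 :: real)" by simp
  \<comment> \<open>Dividing by the total weight \<open>2^k - 1\<close> shrinks the gap of 1 between
    weighted sums to this tolerance.\<close>
  obtain \<W> where \<W>: "\<W> \<in> open_covers (weak_star_topology X)"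
    "\<forall>W\<in>\<W>. \<forall>M\<in>W. \<forall>M'\<in>W. \<forall>\<phi>\<in>\<Phi>. \<bar>(\<integral>x. \<phi> x \<partial>M) - (\<integral>x. \<phi> x \<partial>M')\<bar> < 1 / (2^k - 1)"
    using weak_star_small_cover[OF X \<Phi>(1,2) pos'] by blast
  \<comment> \<open>\<open>mod k\<close> makes the map take values in \<open>X\<close> for every
    natural number, as measurability demands; \<open>\<pi>\<close> integrates only over
    \<open>j < k\<close>, where it changes nothing.\<close>
  define \<mu> where "\<mu> = (\<lambda>x::nat \<Rightarrow> 'a. distr (measure_pmf \<pi>) (restrict_space borel X) (\<lambda>j. x (j mod k)))"
  have \<mu>: "\<mu> x \<in> prob_measures X"
    "continuous_on X \<phi> \<Longrightarrow> (\<integral>y. \<phi> y \<partial>\<mu> x) = (\<Sum>j<k. 2^j * \<phi> (x j)) / (2^k - 1)"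
    if x: "\<And>j. j < k \<Longrightarrow> x j \<in> X" for x and \<phi> :: "'a \<Rightarrow> real"
  proof -
    have m: "(\<lambda>j. x (j mod k)) \<in> measurable (measure_pmf \<pi>) (restrict_space borel X)"
      using x k by (intro measurable_restrict_space2) auto
    show "\<mu> x \<in> prob_measures X"
      using measure_pmf.prob_space_distr[OF m] by (simp add: \<mu>_def prob_measures_def)
    assume "continuous_on X \<phi>"
    then have "(\<integral>y. \<phi> y \<partial>\<mu> x) = (\<integral>j. \<phi> (x (j mod k)) \<partial>measure_pmf \<pi>)"
      unfolding \<mu>_def using m borel_measurable_continuous_on_restrict by (intro integral_distr)
    then show "(\<integral>y. \<phi> y \<partial>\<mu> x) = (\<Sum>j<k. 2^j * \<phi> (x j)) / (2^k - 1)"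
      by (simp add: \<pi>)
  qed
  show ?thesis
  proof (rule bexI[OF _ \<W>(1)], rule allI)
    fix n
    let ?N = "min_subcover (top_of_set X) (join_cover (top_of_set X) f a n \<U>)"
    let ?g = "\<lambda>n. push_forward X (f n)"
    obtain E where E: "E \<subseteq> X" "finite E" "card E = ?N"
      "\<forall>x\<in>E. \<forall>y\<in>E. x \<noteq> y \<longrightarrow> (\<exists>i<n. \<delta> \<le> dist (comp_seq f (a i) x) (comp_seq f (a i) y))"
      using exists_separated_set[of X f \<delta> \<U> ?N a n, OF f \<delta> order_refl] by blast
    have sep: "x = y" if x: "x \<in> {..<k} \<rightarrow>\<^sub>E E" and y: "y \<in> {..<k} \<rightarrow>\<^sub>E E"
      and close: "\<And>i. i < n \<Longrightarrow> \<exists>W\<in>\<W>. comp_seq ?g (a i) (\<mu> x) \<in> W \<and> comp_seq ?g (a i) (\<mu> y) \<in> W" for x y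
    proof (rule ccontr)
      assume "x \<noteq> y"
      then obtain j where j: "j < k" "x j \<noteq> y j" using PiE_ext[OF x y] by auto
      then have "x j \<in> E" "y j \<in> E" using x y by auto
      with E(4) j(2) obtain i where i: "i < n" "\<delta> \<le> dist (comp_seq f (a i) (x j)) (comp_seq f (a i) (y j))"
        by blast
      have in_X: "x j \<in> X" "y j \<in> X" "comp_seq f (a i) (x j) \<in> X" "comp_seq f (a i) (y j) \<in> X" if "j < k" for j
      proof -
        show *: "x j \<in> X" "y j \<in> X" using x y E(1) that by auto
        show "comp_seq f (a i) (x j) \<in> X" "comp_seq f (a i) (y j) \<in> X"
          using * continuous_on_comp_seq(1)[of X f "a i"] f by (simp_all add: image_subset_iff)
      qed
      obtain \<phi> where \<phi>: "\<phi> \<in> \<Phi>" "1 \<le> \<bar>(\<Sum>j<k. 2^j * \<phi> (comp_seq f (a i) (x j))) - (\<Sum>j<k. 2^j * \<phi> (comp_seq f (a i) (y j)))\<bar>"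
        using distinguished[rule_format, of "\<lambda>j. comp_seq f (a i) (x j)" "\<lambda>j. comp_seq f (a i) (y j)"] in_X(3,4) i(2) j(1) by auto
      have c: "continuous_on X \<phi>" using \<Phi>(2) \<phi>(1) .
      have c': "continuous_on X (\<lambda>x. \<phi> (comp_seq f (a i) x))"
        using continuous_on_compose2[OF c continuous_on_comp_seq(2,1)[OF f]] .
      have int: "(\<integral>v. \<phi> v \<partial>comp_seq ?g (a i) (\<mu> z)) = (\<Sum>j<k. 2^j * \<phi> (comp_seq f (a i) (z j))) / (2^k - 1)"
        if z: "\<And>j. j < k \<Longrightarrow> z j \<in> X" for z
        using comp_seq_push_forward(2)[OF f \<mu>(1)[OF z] c] \<mu>(2)[OF z c'] by simp
      obtain W where "W \<in> \<W>" "comp_seq ?g (a i) (\<mu> x) \<in> W" "comp_seq ?g (a i) (\<mu> y) \<in> W"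
        using close[OF i(1)] by blast
      from \<W>(2)[rule_format, OF this \<phi>(1)] have "\<bar>(\<Sum>j<k. 2^j * \<phi> (comp_seq f (a i) (x j))) / (2^k - 1)
          - (\<Sum>j<k. 2^j * \<phi> (comp_seq f (a i) (y j))) / (2^k - 1)\<bar> < 1 / (2^k - 1)"
        using int[of x] int[of y] in_X by simp
      then have "\<bar>(\<Sum>j<k. 2^j * \<phi> (comp_seq f (a i) (x j))) - (\<Sum>j<k. 2^j * \<phi> (comp_seq f (a i) (y j)))\<bar> / (2^k - 1)
          < 1 / (2^k - 1)"
        using pos by (simp flip: diff_divide_distrib add: abs_divide)
      then show False using \<phi>(2) pos by (simp add: divide_less_cancel)
    qed
    have \<mu>E: "\<mu> x \<in> prob_measures X" if "x \<in> {..<k} \<rightarrow>\<^sub>E E" for x using that E(1) by (intro \<mu>(1)) auto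
    have inv: "comp_seq ?g (a i) M \<in> prob_measures X" if "M \<in> prob_measures X" for i M
      using comp_seq_push_forward(1)[OF f that] .
    have cov: "\<Union>\<W> = prob_measures X" "finite \<W>" using \<W>(1) by (auto simp: open_covers_def topspace_weak_star)
    \<comment> \<open>If two tuples give the same measure, then at each time the two images coincide
      and trivially share a member of the cover, so \<open>sep\<close> applies.\<close>
    have "inj_on \<mu> ({..<k} \<rightarrow>\<^sub>E E)"
    proof (rule inj_onI)
      fix x y assume xy: "x \<in> {..<k} \<rightarrow>\<^sub>E E" "y \<in> {..<k} \<rightarrow>\<^sub>E E" "\<mu> x = \<mu> y"
      show "x = y"
      proof (rule sep[OF xy(1,2)])
        fix i
        have "comp_seq ?g (a i) (\<mu> x) \<in> \<Union>\<W>" using inv \<mu>E[OF xy(1)] cov(1) by simp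
        then show "\<exists>W\<in>\<W>. comp_seq ?g (a i) (\<mu> x) \<in> W \<and> comp_seq ?g (a i) (\<mu> y) \<in> W"
          using xy(3) by auto
      qed
    qed
    then have "?N ^ k = card (\<mu> ` ({..<k} \<rightarrow>\<^sub>E E))"
      by (simp add: card_image card_PiE E(3))
    also have "\<dots> \<le> min_subcover (weak_star_topology X) (join_cover (weak_star_topology X) ?g a n \<W>)"
    proof (rule card_le_min_subcover)
      show "finite (join_cover (weak_star_topology X) ?g a n \<W>)" using cov(2) by (rule finite_join_cover)
      show "\<Union>(join_cover (weak_star_topology X) ?g a n \<W>) = topspace (weak_star_topology X)"
        by (rule Union_join_cover[OF \<W>(1)], unfold topspace_weak_star, rule image_subsetI, rule inv)
      show "\<mu> ` ({..<k} \<rightarrow>\<^sub>E E) \<subseteq> topspace (weak_star_topology X)"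
        unfolding topspace_weak_star by (rule image_subsetI) (rule \<mu>E)
      fix V M M' assume "V \<in> join_cover (weak_star_topology X) ?g a n \<W>"
      then obtain U where U: "V = {M \<in> topspace (weak_star_topology X). \<forall>i<n. comp_seq ?g (a i) M \<in> U i}"
          "\<forall>i<n. U i \<in> \<W>"
        unfolding join_cover_eq by blast
      assume "M \<in> \<mu> ` ({..<k} \<rightarrow>\<^sub>E E)" "M' \<in> \<mu> ` ({..<k} \<rightarrow>\<^sub>E E)"
      then obtain x y where xy: "x \<in> {..<k} \<rightarrow>\<^sub>E E" "y \<in> {..<k} \<rightarrow>\<^sub>E E" "M = \<mu> x" "M' = \<mu> y" by blast
      assume "M \<in> V" "M' \<in> V"
      then have "comp_seq ?g (a i) (\<mu> x) \<in> U i" "comp_seq ?g (a i) (\<mu> y) \<in> U i" if "i < n" for i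
        using that unfolding U(1) xy(3,4) by simp_all
      with U(2) have "\<exists>W\<in>\<W>. comp_seq ?g (a i) (\<mu> x) \<in> W \<and> comp_seq ?g (a i) (\<mu> y) \<in> W" if "i < n" for i
        using that by (intro bexI[of _ "U i"]) simp_all
      then have "x = y" by (rule sep[OF xy(1,2)])
      then show "M = M'" using xy by simp
    qed
    finally show "?N ^ k \<le> min_subcover (weak_star_topology X) (join_cover (weak_star_topology X) ?g a n \<W>)" .
  qed
qed

text \<open>The case 0 is included because \<open>ln 0 = 0\<close> by convention; covering numbers
  do vanish when \<open>X\<close> is empty.\<close>

lemma ln_of_nat_nonneg: "0 \<le> ln (real n)"
  by (cases n) auto

theorem seq_entropy_push_forward_infinite:
  fixes X :: "'a::metric_space set"
  assumes X: "compact X" and f: "\<And>n. continuous_on X (f n)" "\<And>n. f n ` X \<subseteq> X"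
    and pos: "0 < seq_entropy (top_of_set X) f a"
  shows "seq_entropy (weak_star_topology X) (\<lambda>n. push_forward X (f n)) a = \<infinity>"
proof -
  let ?N = "\<lambda>\<U> n. min_subcover (top_of_set X) (join_cover (top_of_set X) f a n \<U>)"
  let ?N' = "\<lambda>\<W> n. min_subcover (weak_star_topology X)
    (join_cover (weak_star_topology X) (\<lambda>n. push_forward X (f n)) a n \<W>)"
  obtain \<U> where \<U>: "\<U> \<in> open_covers (top_of_set X)"
      "0 < limsup (\<lambda>n. ereal (ln (real (?N \<U> n)) / real n))"
    using pos unfolding seq_entropy_def less_SUP_iff by blast
  \<comment> \<open>The limsup may be infinite; a real number strictly below it lets the multiples
    \<open>k * c\<close> be compared with arbitrary reals at the end.\<close>
  then obtain c where c: "0 < ereal c" "ereal c < limsup (\<lambda>n. ereal (ln (real (?N \<U> n)) / real n))"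
    using ereal_dense2[OF \<U>(2)] by blast
  have "ereal (real k * c) \<le> seq_entropy (weak_star_topology X) (\<lambda>n. push_forward X (f n)) a" if k: "0 < k" for k
  proof -
    obtain \<W> where \<W>: "\<W> \<in> open_covers (weak_star_topology X)" "\<forall>n. ?N \<U> n ^ k \<le> ?N' \<W> n"
      using min_subcover_power_le[of X f \<U> k a, OF X f \<U>(1) k] by blast
    have le: "real k * (ln (real (?N \<U> n)) / real n) \<le> ln (real (?N' \<W> n)) / real n" for n
    proof (cases "?N \<U> n = 0")
      case True
      then show ?thesis using ln_of_nat_nonneg[of "?N' \<W> n"] by simp
    next
      case False
      have "real k * ln (real (?N \<U> n)) = ln (real (?N \<U> n ^ k))" using False by (simp add: ln_realpow)
      also have "\<dots> \<le> ln (real (?N' \<W> n))"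
        using False \<W>(2)[rule_format, of n] by (intro ln_mono of_nat_mono) simp_all
      finally have "real k * ln (real (?N \<U> n)) / real n \<le> ln (real (?N' \<W> n)) / real n"
        by (rule divide_right_mono) simp
      then show ?thesis by simp
    qed
    have "ereal (real k * c) = ereal (real k) * ereal c" by simp
    also have "\<dots> \<le> ereal (real k) * limsup (\<lambda>n. ereal (ln (real (?N \<U> n)) / real n))"
      using c(2) by (intro ereal_mult_left_mono) auto
    also have "\<dots> = limsup (\<lambda>n. ereal (real k) * ereal (ln (real (?N \<U> n)) / real n))"
      by (rule Limsup_ereal_mult_left[symmetric]) auto
    also have "\<dots> \<le> limsup (\<lambda>n. ereal (ln (real (?N' \<W> n)) / real n))"
      using le by (intro Limsup_mono always_eventually) simp
    also have "\<dots> \<le> seq_entropy (weak_star_topology X) (\<lambda>n. push_forward X (f n)) a"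
      unfolding seq_entropy_def by (rule SUP_upper[OF \<W>(1)])
    finally show ?thesis .
  qed
  note le = this
  show ?thesis
  proof (rule ereal_top)
    fix b :: real
    obtain k :: nat where k: "b / c < real k" using reals_Archimedean2 by blast
    then have "b < real k * c" using c(1) by (simp add: field_simps)
    also have "\<dots> \<le> real (Suc k) * c" using c(1) by (intro mult_right_mono) auto
    finally have "ereal b \<le> ereal (real (Suc k) * c)" by simp
    also have "\<dots> \<le> seq_entropy (weak_star_topology X) (\<lambda>n. push_forward X (f n)) a"
      by (rule le) simp
    finally show "ereal b \<le> seq_entropy (weak_star_topology X) (\<lambda>n. push_forward X (f n)) a" .
  qed
qed

subsection \<open>Zero entropy\<close>

lemma (in prob_space) exists_le_expectation:
  fixes g :: "'a \<Rightarrow> real"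
  assumes "integrable M g"
  shows "\<exists>x\<in>space M. g x \<le> expectation g"
proof (rule ccontr)
  assume "\<not> ?thesis"
  then have "AE x in M. expectation g < g x" by (intro AE_I2) (auto simp: not_le)
  then have "expectation (\<lambda>_. expectation g) < expectation g"
    using assms by (intro integral_less_AE_space) (auto simp: emeasure_space_1)
  then show False by (simp add: prob_space)
qed

text \<open>Maurey's empirical method: sample points are added one at a time, the cross term has mean
  zero, so some choice increases the total square deviation by at most the variances.\<close>

lemma (in prob_space) empirical_approximation:
  fixes \<psi> :: "'i \<Rightarrow> 'a \<Rightarrow> real"
  assumes D: "finite D" and \<psi>: "\<And>d. d \<in> D \<Longrightarrow> \<psi> d \<in> borel_measurable M"
    and b: "\<And>d x. d \<in> D \<Longrightarrow> x \<in> space M \<Longrightarrow> \<bar>\<psi> d x\<bar> \<le> b"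
  shows "\<exists>x. (\<forall>j. x j \<in> space M) \<and>
    (\<Sum>d\<in>D. ((\<Sum>j<k. \<psi> d (x j)) - real k * expectation (\<psi> d))\<^sup>2) \<le> real k * real (card D) * b\<^sup>2"
proof (induction k)
  case 0
  then show ?case using not_empty by (auto intro!: exI[of _ "\<lambda>_. SOME x. x \<in> space M"] some_in_eq[THEN iffD2])
next
  case (Suc k)
  then obtain x where x: "\<And>j. x j \<in> space M"
    "(\<Sum>d\<in>D. ((\<Sum>j<k. \<psi> d (x j)) - real k * expectation (\<psi> d))\<^sup>2) \<le> real k * real (card D) * b\<^sup>2"
    by blast
  define m where "m = (\<lambda>d. expectation (\<psi> d))"
  define s where "s = (\<lambda>d. (\<Sum>j<k. \<psi> d (x j)) - real k * m d)"
  have int: "integrable M (\<psi> d)" "integrable M (\<lambda>y. (\<psi> d y)\<^sup>2)" if "d \<in> D" for d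
  proof -
    show "integrable M (\<psi> d)" using \<psi> b that by (intro integrable_const_bound[of _ b]) auto
    have "(\<psi> d y)\<^sup>2 \<le> b\<^sup>2" if "y \<in> space M" for y
      using b[OF \<open>d \<in> D\<close> that] by (metis abs_ge_zero power2_abs power_mono)
    then show "integrable M (\<lambda>y. (\<psi> d y)\<^sup>2)"
      using \<psi>[OF that] by (intro integrable_const_bound[of _ "b\<^sup>2"]) auto
  qed
  \<comment> \<open>Expanded in powers of \<open>\<psi> d y\<close>, so that only its first two
    moments are integrated. The constants combine to \<open>(s d)^2 - (m d)^2\<close>, and dropping
    the last square leaves the bound \<open>(s d)^2 + b^2\<close>.\<close>
  have expand: "(s d + (\<psi> d y - m d))\<^sup>2 = (s d - m d)\<^sup>2 + 2 * (s d - m d) * \<psi> d y + (\<psi> d y)\<^sup>2" for d y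
    by (simp add: power2_eq_square algebra_simps)
  have int': "integrable M (\<lambda>y. (s d + (\<psi> d y - m d))\<^sup>2)" if "d \<in> D" for d
    unfolding expand using int[OF that] by auto
  have var: "expectation (\<lambda>y. (s d + (\<psi> d y - m d))\<^sup>2) \<le> (s d)\<^sup>2 + b\<^sup>2" if d: "d \<in> D" for d
  proof -
    have "expectation (\<lambda>y. (\<psi> d y)\<^sup>2) \<le> expectation (\<lambda>_. b\<^sup>2)"
    proof (rule integral_mono)
      fix y assume "y \<in> space M"
      then show "(\<psi> d y)\<^sup>2 \<le> b\<^sup>2" using b[OF d] by (metis abs_ge_zero power2_abs power_mono)
    qed (use int[OF d] in auto)
    then have "expectation (\<lambda>y. (\<psi> d y)\<^sup>2) \<le> b\<^sup>2" by (simp add: prob_space)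
    moreover have "expectation (\<lambda>y. (s d + (\<psi> d y - m d))\<^sup>2)
        = (s d - m d)\<^sup>2 + 2 * (s d - m d) * m d + expectation (\<lambda>y. (\<psi> d y)\<^sup>2)"
      unfolding expand using int[OF d] by (simp add: prob_space m_def)
    moreover have "(s d - m d)\<^sup>2 + 2 * (s d - m d) * m d = (s d)\<^sup>2 - (m d)\<^sup>2"
      by (simp add: power2_eq_square algebra_simps)
    ultimately show ?thesis using zero_le_power2[of "m d"] by linarith
  qed
  obtain y where y: "y \<in> space M"
      "(\<Sum>d\<in>D. (s d + (\<psi> d y - m d))\<^sup>2) \<le> expectation (\<lambda>y. \<Sum>d\<in>D. (s d + (\<psi> d y - m d))\<^sup>2)"
    using exists_le_expectation[of "\<lambda>y. \<Sum>d\<in>D. (s d + (\<psi> d y - m d))\<^sup>2"] int' by auto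
  have "expectation (\<lambda>y. \<Sum>d\<in>D. (s d + (\<psi> d y - m d))\<^sup>2) = (\<Sum>d\<in>D. expectation (\<lambda>y. (s d + (\<psi> d y - m d))\<^sup>2))"
    using int' by (rule Bochner_Integration.integral_sum)
  also have "\<dots> \<le> (\<Sum>d\<in>D. (s d)\<^sup>2 + b\<^sup>2)" using var by (rule sum_mono)
  also have "\<dots> = (\<Sum>d\<in>D. (s d)\<^sup>2) + real (card D) * b\<^sup>2" by (simp add: sum.distrib)
  also have "\<dots> \<le> real (Suc k) * real (card D) * b\<^sup>2"
    using x(2) by (simp add: s_def m_def algebra_simps)
  finally have bound: "(\<Sum>d\<in>D. (s d + (\<psi> d y - m d))\<^sup>2) \<le> real (Suc k) * real (card D) * b\<^sup>2"
    using y(2) by linarith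
  have "(\<Sum>j<Suc k. \<psi> d ((x(k := y)) j)) - real (Suc k) * expectation (\<psi> d) = s d + (\<psi> d y - m d)" for d
    by (simp add: s_def m_def algebra_simps)
  with bound have "(\<Sum>d\<in>D. ((\<Sum>j<Suc k. \<psi> d ((x(k := y)) j)) - real (Suc k) * expectation (\<psi> d))\<^sup>2)
      \<le> real (Suc k) * real (card D) * b\<^sup>2" by (simp only:)
  moreover have "\<forall>j. (x(k := y)) j \<in> space M" using x(1) y(1) by simp
  ultimately show ?case by blast
qed

text \<open>Chebyshev's inequality for the counting measure on \<open>D\<close>: each bad index
  contributes at least \<open>(k * \<delta>)^2\<close> to a total of at most
  \<open>k * card D * b^2\<close>. The resulting proportion of bad indices does not depend on
  \<open>D\<close>.\<close>

lemma (in prob_space) empirical_approximation_card: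
  fixes \<psi> :: "'i \<Rightarrow> 'a \<Rightarrow> real"
  assumes D: "finite D" and \<psi>: "\<And>d. d \<in> D \<Longrightarrow> \<psi> d \<in> borel_measurable M"
    and b: "\<And>d x. d \<in> D \<Longrightarrow> x \<in> space M \<Longrightarrow> \<bar>\<psi> d x\<bar> \<le> b" and "0 < k" "0 < \<delta>"
  shows "\<exists>x. (\<forall>j. x j \<in> space M) \<and>
    real (card {d \<in> D. \<delta> < \<bar>(\<Sum>j<k. \<psi> d (x j)) / real k - expectation (\<psi> d)\<bar>})
      \<le> b\<^sup>2 / (real k * \<delta>\<^sup>2) * real (card D)"
proof -
  obtain x where x: "\<forall>j. x j \<in> space M"
    "(\<Sum>d\<in>D. ((\<Sum>j<k. \<psi> d (x j)) - real k * expectation (\<psi> d))\<^sup>2) \<le> real k * real (card D) * b\<^sup>2"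
    using empirical_approximation[of D \<psi> b k] D \<psi> b by blast
  define B where "B = {d \<in> D. \<delta> < \<bar>(\<Sum>j<k. \<psi> d (x j)) / real k - expectation (\<psi> d)\<bar>}"
  have "(real k * \<delta>)\<^sup>2 \<le> ((\<Sum>j<k. \<psi> d (x j)) - real k * expectation (\<psi> d))\<^sup>2" if "d \<in> B" for d
  proof -
    have "\<delta> < \<bar>(\<Sum>j<k. \<psi> d (x j)) / real k - expectation (\<psi> d)\<bar>" using that by (simp add: B_def)
    then have "real k * \<delta> \<le> real k * \<bar>(\<Sum>j<k. \<psi> d (x j)) / real k - expectation (\<psi> d)\<bar>"
      by (intro mult_left_mono) auto
    also have "\<dots> = \<bar>real k * ((\<Sum>j<k. \<psi> d (x j)) / real k - expectation (\<psi> d))\<bar>" by (simp add: abs_mult)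
    also have "real k * ((\<Sum>j<k. \<psi> d (x j)) / real k - expectation (\<psi> d)) = (\<Sum>j<k. \<psi> d (x j)) - real k * expectation (\<psi> d)"
      using \<open>0 < k\<close> by (simp add: field_simps)
    finally have "\<bar>real k * \<delta>\<bar> \<le> \<bar>(\<Sum>j<k. \<psi> d (x j)) - real k * expectation (\<psi> d)\<bar>"
      using \<open>0 < \<delta>\<close> by (simp add: abs_mult)
    then show ?thesis by (simp only: abs_le_square_iff)
  qed
  then have "(\<Sum>d\<in>B. (real k * \<delta>)\<^sup>2) \<le> (\<Sum>d\<in>B. ((\<Sum>j<k. \<psi> d (x j)) - real k * expectation (\<psi> d))\<^sup>2)"
    by (rule sum_mono)
  also have "\<dots> \<le> (\<Sum>d\<in>D. ((\<Sum>j<k. \<psi> d (x j)) - real k * expectation (\<psi> d))\<^sup>2)"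
    using D by (intro sum_mono2) (auto simp: B_def)
  also note x(2)
  finally have "real (card B) * (real k * \<delta>)\<^sup>2 \<le> real k * real (card D) * b\<^sup>2" by simp
  then have "real (card B) \<le> b\<^sup>2 / (real k * \<delta>\<^sup>2) * real (card D)"
    using \<open>0 < k\<close> \<open>0 < \<delta>\<close> by (simp add: field_simps power2_eq_square)
  then show ?thesis using x(1) unfolding B_def by blast
qed

text \<open>A generating function in place of binomial estimates: give each nonzero value weight
  \<open>t\<close> and each zero weight 1. A sparse function then weighs at least
  \<open>t powr r\<close>, while the total weight of all functions factorises over \<open>D\<close>
  into \<open>(1 + q * t) ^ card D\<close>.\<close>

lemma card_sparse_functions_le:
  fixes t r :: real
  assumes D: "finite D" and t: "0 < t" "t \<le> 1"
  shows "real (card {w \<in> D \<rightarrow>\<^sub>E {0..q::nat}. real (card {d \<in> D. w d \<noteq> 0}) \<le> r})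
    \<le> (1 + real q * t) ^ card D * t powr (- r)"
proof -
  define S where "S = {w \<in> D \<rightarrow>\<^sub>E {0..q}. real (card {d \<in> D. w d \<noteq> 0}) \<le> r}"
  define weight where "weight = (\<lambda>v::nat. if v = 0 then 1 else t)"
  have fin: "finite (D \<rightarrow>\<^sub>E {0..q})" using D by (intro finite_PiE) auto
  have "t powr r \<le> (\<Prod>d\<in>D. weight (w d))" if "w \<in> S" for w
  proof -
    have "(\<Prod>d\<in>D. weight (w d)) = t ^ card {d \<in> D. w d \<noteq> 0}"
      using D by (simp add: weight_def prod.If_cases Int_def)
    also have "\<dots> = t powr real (card {d \<in> D. w d \<noteq> 0})" using t by (simp add: powr_realpow)
    also have "\<dots> \<ge> t powr r" using that t by (intro powr_mono') (auto simp: S_def)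
    finally show ?thesis .
  qed
  then have "(\<Sum>w\<in>S. t powr r) \<le> (\<Sum>w\<in>S. \<Prod>d\<in>D. weight (w d))" by (rule sum_mono)
  also have "\<dots> \<le> (\<Sum>w\<in>D \<rightarrow>\<^sub>E {0..q}. \<Prod>d\<in>D. weight (w d))"
    using t fin by (intro sum_mono2) (auto simp: S_def weight_def intro!: prod_nonneg)
  also have "\<dots> = (\<Prod>d\<in>D. \<Sum>v\<in>{0..q}. weight v)"
    using prod_sum_PiE[of D "\<lambda>_. {0..q}" "\<lambda>_ v. weight v"] D by simp
  also have "(\<Sum>v\<in>{0..q}. weight v) = 1 + real q * t"
    by (simp add: weight_def sum.atLeast_Suc_atMost)
  finally have "real (card S) * t powr r \<le> (1 + real q * t) ^ card D" by simp
  then show ?thesis using t by (simp add: S_def powr_minus field_simps)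
qed

section \<open>Coding measures by cells and exceptional values\<close>

lemma small_oscillation_cover:
  fixes X :: "'a::metric_space set" and \<Phi> :: "('a \<Rightarrow> real) set"
  assumes X: "compact X" and \<Phi>: "finite \<Phi>" "\<And>\<phi>. \<phi> \<in> \<Phi> \<Longrightarrow> continuous_on X \<phi>" and \<delta>: "0 < \<delta>"
  shows "\<exists>\<U>\<in>open_covers (top_of_set X). \<forall>U\<in>\<U>. \<forall>x\<in>U. \<forall>y\<in>U. \<forall>\<phi>\<in>\<Phi>. \<bar>\<phi> x - \<phi> y\<bar> < \<delta>"
proof -
  define N where "N = (\<lambda>x. X \<inter> (\<Inter>\<phi>\<in>\<Phi>. X \<inter> \<phi> -` ball (\<phi> x) (\<delta>/2)))"
  have op: "openin (top_of_set X) (N x)" for x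
  proof (cases "\<Phi> = {}")
    case True
    then show ?thesis by (simp add: N_def)
  next
    case False
    then show ?thesis unfolding N_def using \<Phi>
      by (intro openin_Int openin_INT2 continuous_openin_preimage_gen open_ball) auto
  qed
  have "x \<in> N x" if "x \<in> X" for x using that \<delta> by (auto simp: N_def)
  then have cov: "topspace (top_of_set X) \<subseteq> \<Union>(N ` X)" by auto
  have "compactin (top_of_set X) X" using X by (simp add: compactin_subtopology)
  then obtain \<F> where \<F>: "finite \<F>" "\<F> \<subseteq> N ` X" "topspace (top_of_set X) \<subseteq> \<Union>\<F>"
    using compactinD[of "top_of_set X" X "N ` X"] cov op by auto
  show ?thesis
  proof (intro bexI[of _ \<F>] ballI)
    show "\<F> \<in> open_covers (top_of_set X)"
      unfolding open_covers_def
    proof (intro CollectI conjI ballI)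
      show "openin (top_of_set X) U" if "U \<in> \<F>" for U using that \<F>(2) op by auto
      show "\<Union>\<F> = topspace (top_of_set X)" using \<F> by (auto simp: N_def)
    qed (rule \<F>)
    fix U x y \<phi> assume U: "U \<in> \<F>" "x \<in> U" "y \<in> U" and \<phi>: "\<phi> \<in> \<Phi>"
    then obtain z where "x \<in> N z" "y \<in> N z" using \<F>(2) by auto
    then have "\<phi> x \<in> ball (\<phi> z) (\<delta>/2)" "\<phi> y \<in> ball (\<phi> z) (\<delta>/2)"
      using \<phi> unfolding N_def by blast+
    then have "\<bar>\<phi> z - \<phi> x\<bar> < \<delta>/2" "\<bar>\<phi> z - \<phi> y\<bar> < \<delta>/2" by (simp_all add: dist_real_def)
    then show "\<bar>\<phi> x - \<phi> y\<bar> < \<delta>" by linarith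
  qed
qed

text \<open>A measure is coded by the cells of its \<open>k\<close> sample points together with its
  rounded integrals at the exceptional pairs of index and test function. Measures with equal codes
  fall into a common member of the join, so the number of codes bounds the covering number: a
  \<open>k\<close>-th power for the cells times a count of sparse functions.\<close>

lemma min_subcover_weak_star_le:
  fixes X :: "'a::metric_space set" and \<Phi> :: "('a \<Rightarrow> real) set"
  assumes f: "\<And>n. continuous_on X (f n)" "\<And>n. f n ` X \<subseteq> X"
    and \<Phi>: "finite \<Phi>" "\<And>\<phi>. \<phi> \<in> \<Phi> \<Longrightarrow> continuous_on X \<phi>"
    and b: "0 < b" "\<forall>\<phi>\<in>\<Phi>. \<forall>x\<in>X. \<bar>\<phi> x\<bar> \<le> b"
    and \<delta>: "0 < \<delta>" "\<forall>M\<in>prob_measures X. \<exists>W\<in>\<W>. weak_ball X \<Phi> (4 * \<delta>) M \<subseteq> W"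
    and \<U>: "\<U> \<in> open_covers (top_of_set X)"
      "\<forall>U\<in>\<U>. \<forall>x\<in>U. \<forall>y\<in>U. \<forall>\<phi>\<in>\<Phi>. \<bar>\<phi> x - \<phi> y\<bar> < \<delta>"
    and t: "0 < t" "t \<le> 1" and k: "0 < k"
    and q: "q = Suc (nat \<lfloor>2 * b / \<delta>\<rfloor>)"
  shows "real (min_subcover (weak_star_topology X)
        (join_cover (weak_star_topology X) (\<lambda>n. push_forward X (f n)) a n \<W>))
    \<le> real (min_subcover (top_of_set X) (join_cover (top_of_set X) f a n \<U>)) ^ k
      * ((1 + real q * t) ^ (n * card \<Phi>) * t powr (- (b\<^sup>2 / (real k * \<delta>\<^sup>2) * real (n * card \<Phi>))))"
proof -
  let ?g = "\<lambda>n. push_forward X (f n)"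
  let ?J = "join_cover (top_of_set X) f a n \<U>"
  let ?r = "b\<^sup>2 / (real k * \<delta>\<^sup>2) * real (n * card \<Phi>)"
  have inv: "comp_seq f j x \<in> X" if "x \<in> X" for j x
    using continuous_on_comp_seq(1)[of X f j] f that by (simp add: image_subset_iff)
  have J: "finite ?J" using \<U>(1) by (intro finite_join_cover) (simp add: open_covers_def)
  have "\<Union>?J = topspace (top_of_set X)"
    by (rule Union_join_cover[OF \<U>(1)]) (simp add: image_subset_iff inv)
  from min_subcover_attained[OF J this] obtain \<V> where \<V>: "\<V> \<subseteq> ?J" "\<Union>\<V> = topspace (top_of_set X)" "finite \<V>"
      "card \<V> = min_subcover (top_of_set X) ?J"
    by blast
  define D where "D = {..<n} \<times> \<Phi>"
  define \<psi> where "\<psi> = (\<lambda>(i, \<phi>) x. \<phi> (comp_seq f (a i) x) :: real)"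
  have D: "finite D" "card D = n * card \<Phi>" using \<Phi>(1) by (simp_all add: D_def)
  have \<psi>: "continuous_on X (\<psi> d)" if dD: "d \<in> D" for d
  proof -
    obtain i \<phi> where d: "d = (i, \<phi>)" "\<phi> \<in> \<Phi>" using dD by (auto simp: D_def)
    show ?thesis
      using continuous_on_compose2[OF \<Phi>(2)[OF d(2)] continuous_on_comp_seq(2,1)[OF f]] by (simp add: d \<psi>_def)
  qed
  have \<psi>b: "\<bar>\<psi> d x\<bar> \<le> b" if "d \<in> D" "x \<in> X" for d x
    using that inv b(2) by (auto simp: D_def \<psi>_def)
  have \<psi>V: "\<bar>\<psi> d x - \<psi> d y\<bar> < \<delta>" if V: "V \<in> \<V>" "x \<in> V" "y \<in> V" "d \<in> D" for V x y d
  proof -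
    obtain U where "V = {x \<in> topspace (top_of_set X). \<forall>i<n. comp_seq f (a i) x \<in> U i}" "\<forall>i<n. U i \<in> \<U>"
      using \<V>(1) V(1) unfolding join_cover_eq by blast
    with V \<U>(2) show ?thesis by (auto simp: D_def \<psi>_def)
  qed
  define avg where "avg = (\<lambda>x d. (\<Sum>j<k. \<psi> d (x j)) / real k)"
  define bad where "bad = (\<lambda>M x. {d \<in> D. \<delta> < \<bar>avg x d - (\<integral>y. \<psi> d y \<partial>M)\<bar>})"
  have "\<forall>M\<in>prob_measures X. \<exists>x. (\<forall>j. x j \<in> X) \<and> real (card (bad M x)) \<le> ?r"
  proof
    fix M assume M: "M \<in> prob_measures X"
    interpret prob_space M using M by (simp add: prob_measures_def)
    have "\<exists>x. (\<forall>j. x j \<in> space M) \<and>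
        real (card {d \<in> D. \<delta> < \<bar>(\<Sum>j<k. \<psi> d (x j)) / real k - expectation (\<psi> d)\<bar>})
          \<le> b\<^sup>2 / (real k * \<delta>\<^sup>2) * real (card D)"
      using \<psi>b space_prob_measures[OF M] k \<delta>(1) measurable_prob_measures[OF M \<psi>]
      by (intro empirical_approximation_card D(1)) auto
    then show "\<exists>x. (\<forall>j. x j \<in> X) \<and> real (card (bad M x)) \<le> ?r"
      unfolding bad_def avg_def D(2) space_prob_measures[OF M] .
  qed
  from bchoice[OF this] obtain x where x: "\<And>M j. M \<in> prob_measures X \<Longrightarrow> x M j \<in> X"
      "\<And>M. M \<in> prob_measures X \<Longrightarrow> real (card (bad M (x M))) \<le> ?r"
    by blast
  have "\<forall>y\<in>X. \<exists>V. V \<in> \<V> \<and> y \<in> V" using \<V>(2) by auto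
  from bchoice[OF this] obtain v where v: "\<And>y. y \<in> X \<Longrightarrow> v y \<in> \<V>" "\<And>y. y \<in> X \<Longrightarrow> y \<in> v y" by blast
  \<comment> \<open>The value 0 is reserved for good pairs, hence the \<open>Suc\<close>. Adding
    \<open>b\<close> makes the rounded quantity range over \<open>[0, 2 * b / \<delta>]\<close>,
    which explains \<open>q\<close>.\<close>
  define code where "code = (\<lambda>M. \<lambda>d\<in>D. if d \<in> bad M (x M) then Suc (nat \<lfloor>((\<integral>y. \<psi> d y \<partial>M) + b) / \<delta>\<rfloor>) else 0)"
  define \<tau> where "\<tau> = (\<lambda>M. (\<lambda>j\<in>{..<k}. v (x M j), code M))"
  define S where "S = {w \<in> D \<rightarrow>\<^sub>E {0..q}. real (card {d \<in> D. w d \<noteq> 0}) \<le> ?r}"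
  have int_b: "\<bar>\<integral>y. \<psi> d y \<partial>M\<bar> \<le> b" if M: "M \<in> prob_measures X" and d: "d \<in> D" for M d
  proof -
    interpret prob_space M using M by (simp add: prob_measures_def)
    have "integrable M (\<psi> d)"
      using \<psi>b[OF d] space_prob_measures[OF M] measurable_prob_measures[OF M \<psi>[OF d]]
      by (intro integrable_const_bound[of _ b]) auto
    moreover have "\<psi> d y \<le> b" "- b \<le> \<psi> d y" if "y \<in> space M" for y
      using \<psi>b[OF d, of y] that space_prob_measures[OF M] by (auto simp: abs_le_iff)
    ultimately have "(\<integral>y. \<psi> d y \<partial>M) \<le> (\<integral>y. b \<partial>M)" "(\<integral>y. - b \<partial>M) \<le> (\<integral>y. \<psi> d y \<partial>M)"
      by (intro integral_mono; simp)+
    then show ?thesis by (simp add: prob_space abs_le_iff)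
  qed
  have \<tau>: "\<tau> M \<in> ({..<k} \<rightarrow>\<^sub>E \<V>) \<times> S" if M: "M \<in> prob_measures X" for M
  proof -
    have "code M \<in> D \<rightarrow>\<^sub>E {0..q}"
    proof (rule PiE_I)
      fix d assume d: "d \<in> D"
      have "((\<integral>y. \<psi> d y \<partial>M) + b) / \<delta> \<le> 2 * b / \<delta>"
        using int_b[OF M d] \<delta>(1) by (intro divide_right_mono) (auto simp: abs_le_iff)
      then have "nat \<lfloor>((\<integral>y. \<psi> d y \<partial>M) + b) / \<delta>\<rfloor> \<le> nat \<lfloor>2 * b / \<delta>\<rfloor>"
        by (intro nat_mono floor_mono)
      then show "code M d \<in> {0..q}" using d by (simp add: code_def q)
    qed (simp add: code_def)
    moreover have "{d \<in> D. code M d \<noteq> 0} = bad M (x M)" by (auto simp: code_def bad_def)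
    ultimately have "code M \<in> S" using x(2)[OF M] by (simp add: S_def)
    moreover have "(\<lambda>j\<in>{..<k}. v (x M j)) \<in> {..<k} \<rightarrow>\<^sub>E \<V>"
      by (intro restrict_PiE_iff[THEN iffD2] ballI v(1) x(1) M)
    ultimately show ?thesis unfolding \<tau>_def by (intro SigmaI)
  qed
  \<comment> \<open>At a bad pair the equal rounded values leave a difference below
    \<open>\<delta>\<close>. At a good pair there are three errors of at most
    \<open>\<delta>\<close>: two from the empirical averages and one from points sharing a cell. The
    sum \<open>3 * \<delta>\<close> is strictly below the radius
    \<open>4 * \<delta>\<close>.\<close>
  have same: "\<bar>(\<integral>y. \<psi> d y \<partial>M) - (\<integral>y. \<psi> d y \<partial>M')\<bar> < 4 * \<delta>"
    if M: "M \<in> prob_measures X" "M' \<in> prob_measures X" and eq: "\<tau> M = \<tau> M'" and d: "d \<in> D" for M M' d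
  proof -
    have code: "code M d = code M' d" using eq by (simp add: \<tau>_def)
    show ?thesis
    proof (cases "d \<in> bad M (x M)")
      case True
      with code d have "d \<in> bad M' (x M')" by (auto simp: code_def split: if_splits)
      with True code d have n: "nat \<lfloor>((\<integral>y. \<psi> d y \<partial>M) + b) / \<delta>\<rfloor> = nat \<lfloor>((\<integral>y. \<psi> d y \<partial>M') + b) / \<delta>\<rfloor>"
        by (simp add: code_def)
      have "0 \<le> ((\<integral>y. \<psi> d y \<partial>M) + b) / \<delta>" "0 \<le> ((\<integral>y. \<psi> d y \<partial>M') + b) / \<delta>"
        using int_b[OF M(1) d] int_b[OF M(2) d] \<delta>(1) by auto
      with n have "\<lfloor>((\<integral>y. \<psi> d y \<partial>M) + b) / \<delta>\<rfloor> = \<lfloor>((\<integral>y. \<psi> d y \<partial>M') + b) / \<delta>\<rfloor>"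
        by (simp add: eq_nat_nat_iff)
      then have "\<bar>((\<integral>y. \<psi> d y \<partial>M) + b) / \<delta> - ((\<integral>y. \<psi> d y \<partial>M') + b) / \<delta>\<bar> < 1" by linarith
      also have "((\<integral>y. \<psi> d y \<partial>M) + b) / \<delta> - ((\<integral>y. \<psi> d y \<partial>M') + b) / \<delta>
          = ((\<integral>y. \<psi> d y \<partial>M) - (\<integral>y. \<psi> d y \<partial>M')) / \<delta>"
        by (simp add: diff_divide_distrib add_divide_distrib)
      finally show ?thesis using \<delta>(1) by (simp add: abs_divide)
    next
      case False
      with code d have "d \<notin> bad M' (x M')" by (auto simp: code_def split: if_splits)
      with False d have close: "\<bar>avg (x M) d - (\<integral>y. \<psi> d y \<partial>M)\<bar> \<le> \<delta>" "\<bar>avg (x M') d - (\<integral>y. \<psi> d y \<partial>M')\<bar> \<le> \<delta>"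
        by (auto simp: bad_def)
      have "\<bar>\<psi> d (x M j) - \<psi> d (x M' j)\<bar> \<le> \<delta>" if "j < k" for j
      proof -
        have "restrict (\<lambda>j. v (x M j)) {..<k} j = restrict (\<lambda>j. v (x M' j)) {..<k} j"
          using eq by (simp add: \<tau>_def)
        then have "v (x M j) = v (x M' j)" using that by simp
        then have "\<bar>\<psi> d (x M j) - \<psi> d (x M' j)\<bar> < \<delta>"
          using v(1,2)[OF x(1)[OF M(1), of j]] v(2)[OF x(1)[OF M(2), of j]] by (intro \<psi>V[OF _ _ _ d]) auto
        then show ?thesis by simp
      qed
      then have "\<bar>\<Sum>j<k. \<psi> d (x M j) - \<psi> d (x M' j)\<bar> \<le> (\<Sum>j<k. \<delta>)"
        by (intro order_trans[OF sum_abs] sum_mono) auto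
      then have "\<bar>(\<Sum>j<k. \<psi> d (x M j)) - (\<Sum>j<k. \<psi> d (x M' j))\<bar> \<le> real k * \<delta>"
        by (simp add: sum_subtractf)
      then have "\<bar>(\<Sum>j<k. \<psi> d (x M j)) - (\<Sum>j<k. \<psi> d (x M' j))\<bar> / real k \<le> \<delta>"
        using k by (simp add: pos_divide_le_eq mult.commute)
      then have "\<bar>avg (x M) d - avg (x M') d\<bar> \<le> \<delta>"
        by (simp add: avg_def abs_divide flip: diff_divide_distrib)
      then show ?thesis using close \<delta>(1) by linarith
    qed
  qed
  have finS: "finite S" using D(1) finite_PiE[of D "\<lambda>_. {0..q}"] by (auto simp: S_def)
  have fin: "finite (({..<k} \<rightarrow>\<^sub>E \<V>) \<times> S)" using \<V>(3) finS by (intro finite_cartesian_product finite_PiE) auto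
  have sub: "\<tau> ` prob_measures X \<subseteq> ({..<k} \<rightarrow>\<^sub>E \<V>) \<times> S" using \<tau> by blast
  have "min_subcover (weak_star_topology X) (join_cover (weak_star_topology X) ?g a n \<W>)
      \<le> card (\<tau> ` prob_measures X)"
  proof (rule min_subcover_le)
    show "finite (\<tau> ` prob_measures X)" using sub fin by (rule finite_subset)
    show "\<exists>s\<in>\<tau> ` prob_measures X. M \<in> {M \<in> prob_measures X. \<tau> M = s}"
      if "M \<in> topspace (weak_star_topology X)" for M
      using that by (auto simp: topspace_weak_star)
    fix s assume "s \<in> \<tau> ` prob_measures X"
    then obtain M where M: "M \<in> prob_measures X" "s = \<tau> M" by blast
    have "\<forall>i. \<exists>W. W \<in> \<W> \<and> weak_ball X \<Phi> (4 * \<delta>) (comp_seq ?g (a i) M) \<subseteq> W"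
      using \<delta>(2)[rule_format, OF comp_seq_push_forward(1)[where f = f and X = X, OF f M(1)]] by blast
    from choice[OF this] obtain W where W: "\<And>i. W i \<in> \<W>"
        "\<And>i. weak_ball X \<Phi> (4 * \<delta>) (comp_seq ?g (a i) M) \<subseteq> W i" by blast
    have "comp_seq ?g (a i) M' \<in> W i" if M': "M' \<in> prob_measures X" "\<tau> M' = s" and i: "i < n" for M' i
    proof -
      have "\<bar>(\<integral>y. \<phi> y \<partial>comp_seq ?g (a i) M') - (\<integral>y. \<phi> y \<partial>comp_seq ?g (a i) M)\<bar> < 4 * \<delta>" if "\<phi> \<in> \<Phi>" for \<phi>
      proof -
        have "(i, \<phi>) \<in> D" using i that by (simp add: D_def)
        from same[OF M'(1) M(1) _ this] M' M
        have "\<bar>(\<integral>y. \<phi> (comp_seq f (a i) y) \<partial>M') - (\<integral>y. \<phi> (comp_seq f (a i) y) \<partial>M)\<bar> < 4 * \<delta>"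
          by (simp add: \<psi>_def)
        then show ?thesis
          using comp_seq_push_forward(2)[OF f M'(1) \<Phi>(2)[OF that], where m = "a i"]
            comp_seq_push_forward(2)[OF f M(1) \<Phi>(2)[OF that], where m = "a i"] by simp
      qed
      then have "comp_seq ?g (a i) M' \<in> weak_ball X \<Phi> (4 * \<delta>) (comp_seq ?g (a i) M)"
        using comp_seq_push_forward(1)[OF f M'(1)] by (simp add: weak_ball_def)
      then show ?thesis using W(2) by blast
    qed
    then have "{M \<in> prob_measures X. \<tau> M = s}
        \<subseteq> {M \<in> topspace (weak_star_topology X). \<forall>i<n. comp_seq ?g (a i) M \<in> W i}"
      by (auto simp: topspace_weak_star)
    moreover have "{M \<in> topspace (weak_star_topology X). \<forall>i<n. comp_seq ?g (a i) M \<in> W i}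
        \<in> join_cover (weak_star_topology X) ?g a n \<W>"
      unfolding join_cover_eq using W(1) by blast
    ultimately show "\<exists>V\<in>join_cover (weak_star_topology X) ?g a n \<W>. {M \<in> prob_measures X. \<tau> M = s} \<subseteq> V"
      by blast
  qed (rule join_cover_subset)
  also have "\<dots> \<le> card (({..<k} \<rightarrow>\<^sub>E \<V>) \<times> S)" using fin sub by (rule card_mono)
  also have "\<dots> = min_subcover (top_of_set X) ?J ^ k * card S"
    by (simp add: card_cartesian_product card_PiE \<V>(4))
  finally have "real (min_subcover (weak_star_topology X) (join_cover (weak_star_topology X) ?g a n \<W>))
      \<le> real (min_subcover (top_of_set X) ?J) ^ k * real (card S)"
    by (metis of_nat_le_iff of_nat_mult of_nat_power)
  also have "\<dots> \<le> real (min_subcover (top_of_set X) ?J) ^ k * ((1 + real q * t) ^ (n * card \<Phi>) * t powr (- ?r))"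
    using card_sparse_functions_le[OF D(1) t, of q ?r] unfolding D(2) S_def by (intro mult_left_mono) auto
  finally show ?thesis .
qed

text \<open>After taking logarithms and dividing by \<open>n\<close>, the counting bound has three
  terms: \<open>k\<close> times the base rate, \<open>c * ln (1 + q * t)\<close>, and
  \<open>c * (b^2 / (k * \<delta>^2)) * - ln t\<close>. Each is made at most
  \<open>\<eta> / 3\<close>.\<close>

theorem seq_entropy_push_forward_nonpos:
  fixes X :: "'a::metric_space set"
  assumes X: "compact X" and f: "\<And>n. continuous_on X (f n)" "\<And>n. f n ` X \<subseteq> X"
    and zero: "seq_entropy (top_of_set X) f a \<le> 0"
  shows "seq_entropy (weak_star_topology X) (\<lambda>n. push_forward X (f n)) a \<le> 0"
  unfolding seq_entropy_def
proof (rule SUP_least)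
  fix \<W> assume \<W>: "\<W> \<in> open_covers (weak_star_topology X)"
  let ?N' = "\<lambda>n. min_subcover (weak_star_topology X)
    (join_cover (weak_star_topology X) (\<lambda>n. push_forward X (f n)) a n \<W>)"
  obtain \<Phi> e where \<Phi>: "finite \<Phi>" "\<And>\<phi>. \<phi> \<in> \<Phi> \<Longrightarrow> continuous_on X \<phi>" "0 < e"
      "\<forall>M\<in>prob_measures X. \<exists>W\<in>\<W>. weak_ball X \<Phi> e M \<subseteq> W"
    using weak_star_Lebesgue_number[OF X \<W>] by blast
  define \<delta> where "\<delta> = e / 4"
  have \<delta>: "0 < \<delta>" "4 * \<delta> = e" using \<Phi>(3) by (simp_all add: \<delta>_def)
  have "\<forall>\<phi>\<in>\<Phi>. \<exists>b. \<forall>x\<in>X. \<bar>\<phi> x\<bar> \<le> b"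
  proof
    fix \<phi> assume "\<phi> \<in> \<Phi>"
    from continuous_on_compact_bounded[OF X \<Phi>(2)[OF this]] show "\<exists>b. \<forall>x\<in>X. \<bar>\<phi> x\<bar> \<le> b" by metis
  qed
  from bchoice[OF this] obtain \<beta> where \<beta>: "\<And>\<phi> x. \<phi> \<in> \<Phi> \<Longrightarrow> x \<in> X \<Longrightarrow> \<bar>\<phi> x\<bar> \<le> \<beta> \<phi>" by blast
  define b where "b = Max (insert 1 (\<beta> ` \<Phi>))"
  have b: "0 < b" "\<forall>\<phi>\<in>\<Phi>. \<forall>x\<in>X. \<bar>\<phi> x\<bar> \<le> b"
  proof -
    have "1 \<le> b" unfolding b_def using \<Phi>(1) by (intro Max_ge) auto
    then show "0 < b" by simp
    have "\<bar>\<phi> x\<bar> \<le> b" if "\<phi> \<in> \<Phi>" "x \<in> X" for \<phi> x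
    proof -
      have "\<beta> \<phi> \<le> b" unfolding b_def using \<Phi>(1) that(1) by (intro Max_ge) auto
      with \<beta>[OF that] show ?thesis by (rule order_trans)
    qed
    then show "\<forall>\<phi>\<in>\<Phi>. \<forall>x\<in>X. \<bar>\<phi> x\<bar> \<le> b" by blast
  qed
  obtain \<U> where \<U>: "\<U> \<in> open_covers (top_of_set X)"
      "\<forall>U\<in>\<U>. \<forall>x\<in>U. \<forall>y\<in>U. \<forall>\<phi>\<in>\<Phi>. \<bar>\<phi> x - \<phi> y\<bar> < \<delta>"
    using small_oscillation_cover[OF X \<Phi>(1,2) \<delta>(1)] by blast
  let ?N = "\<lambda>n. min_subcover (top_of_set X) (join_cover (top_of_set X) f a n \<U>)"
  define q where "q = Suc (nat \<lfloor>2 * b / \<delta>\<rfloor>)"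
  define c where "c = real (card \<Phi>)"
  have c: "0 \<le> c" by (simp add: c_def)
  have limsupN: "limsup (\<lambda>n. ereal (ln (real (?N n)) / real n)) \<le> 0"
    using zero SUP_upper[OF \<U>(1)] unfolding seq_entropy_def by (rule order_trans[rotated])
  show "limsup (\<lambda>n. ereal (ln (real (?N' n)) / real n)) \<le> 0"
  proof (rule ereal_le_epsilon2)
    fix \<eta> :: real assume \<eta>: "0 < \<eta>"
    \<comment> \<open>Chosen through \<open>ln (1 + q * t) \<le> q * t\<close>. The summand 1 in the
      denominator covers an empty test family, where \<open>c = 0\<close>.\<close>
    define t where "t = min 1 (\<eta> / (3 * (c * real q + 1)))"
    have t: "0 < t" "t \<le> 1" using \<eta> c by (auto simp: t_def intro!: divide_pos_pos add_nonneg_pos)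
    have ct: "c * (real q * t) \<le> \<eta> / 3"
    proof -
      have "c * real q * t \<le> (c * real q + 1) * (\<eta> / (3 * (c * real q + 1)))"
        using c t by (intro mult_mono) (auto simp: t_def)
      also have "\<dots> = \<eta> / 3"
      proof -
        have "c * real q + 1 \<noteq> 0" using c by (metis add_nonneg_pos less_irrefl mult_nonneg_nonneg of_nat_0_le_iff zero_less_one)
        then show ?thesis by (simp add: field_simps)
      qed
      finally show ?thesis by (simp add: mult.assoc)
    qed
    \<comment> \<open>\<open>k\<close> has to follow \<open>t\<close>, because it must outweigh
      \<open>- ln t\<close>, which grows as \<open>t\<close> shrinks.\<close>
    obtain k0 :: nat where k0: "3 * (c * (b\<^sup>2 / \<delta>\<^sup>2) * - ln t) / \<eta> < real k0"
      using reals_Archimedean2 by blast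
    define k where "k = Suc k0"
    have k: "0 < k" "3 * (c * (b\<^sup>2 / \<delta>\<^sup>2) * - ln t) / \<eta> < real k" using k0 by (auto simp: k_def)
    have ck: "c * (b\<^sup>2 / (real k * \<delta>\<^sup>2)) * - ln t \<le> \<eta> / 3"
    proof -
      define z where "z = c * (b\<^sup>2 / \<delta>\<^sup>2) * - ln t"
      have "3 * z < real k * \<eta>" using k(2) \<eta> unfolding z_def by (simp only: pos_divide_less_eq)
      then have "z / real k \<le> \<eta> / 3" using k(1) by (simp add: field_simps)
      moreover have "c * (b\<^sup>2 / (real k * \<delta>\<^sup>2)) * - ln t = z / real k" by (simp add: z_def mult.commute)
      ultimately show ?thesis by simp
    qed
    \<comment> \<open>With \<open>k\<close> now fixed, zero base entropy allows a rate so small that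
      its \<open>k\<close>-fold is still at most \<open>\<eta> / 3\<close>.\<close>
    have "limsup (\<lambda>n. ereal (ln (real (?N n)) / real n)) < ereal (\<eta> / (3 * real k))"
      using limsupN \<eta> k(1) by (auto intro: order_le_less_trans)
    then have ev: "eventually (\<lambda>n. ereal (ln (real (?N n)) / real n) < ereal (\<eta> / (3 * real k))) sequentially"
      by (rule Limsup_lessD)
    have "eventually (\<lambda>n. ereal (ln (real (?N' n)) / real n) \<le> ereal \<eta>) sequentially"
      using ev eventually_gt_at_top[of 0]
    proof eventually_elim
      case (elim n)
      show ?case
      proof (cases "?N' n = 0")
        case True
        then show ?thesis using \<eta> by simp
      next
        case False
        let ?P = "(1 + real q * t) ^ (n * card \<Phi>)"
        let ?r = "b\<^sup>2 / (real k * \<delta>\<^sup>2) * real (n * card \<Phi>)"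
        have le: "real (?N' n) \<le> real (?N n) ^ k * (?P * t powr (- ?r))"
          by (rule min_subcover_weak_star_le[where X = X and f = f and \<Phi> = \<Phi> and b = b, OF f \<Phi>(1,2) b \<delta>(1) \<Phi>(4)[folded \<delta>(2)] \<U> t k(1) q_def])
        have qt: "0 < 1 + real q * t" using t by (simp add: add_pos_nonneg)
        have "?N n \<noteq> 0"
        proof
          assume "?N n = 0"
          then show False using le False by (simp add: zero_power[OF k(1)])
        qed
        then have N: "0 < real (?N n)" by simp
        have "ln (real (?N' n)) \<le> ln (real (?N n) ^ k * (?P * t powr (- ?r)))"
          using False le by (intro ln_mono) auto
        also have "\<dots> = real k * ln (real (?N n)) + (real (n * card \<Phi>) * ln (1 + real q * t) + ?r * - ln t)"
          using N qt t by (simp add: ln_mult ln_realpow ln_powr)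
        also have "\<dots> \<le> real k * ln (real (?N n)) + (real (n * card \<Phi>) * (real q * t) + ?r * - ln t)"
          using t by (intro add_left_mono add_right_mono mult_left_mono ln_add_one_self_le_self) auto
        also have "\<dots> = real k * ln (real (?N n)) + real n * (c * (real q * t) + c * (b\<^sup>2 / (real k * \<delta>\<^sup>2)) * - ln t)"
          by (simp add: c_def algebra_simps)
        also have "\<dots> \<le> real n * (\<eta> / 3) + real n * (\<eta> / 3 + \<eta> / 3)"
        proof (intro add_mono mult_left_mono ct ck)
          have "ln (real (?N n)) < \<eta> / (3 * real k) * real n" using elim by (simp add: pos_divide_less_eq)
          then have "real k * ln (real (?N n)) \<le> real k * (\<eta> / (3 * real k) * real n)"
            by (intro mult_left_mono) auto
          also have "\<dots> = real n * (\<eta> / 3)" using k(1) by simp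
          finally show "real k * ln (real (?N n)) \<le> real n * (\<eta> / 3)" .
        qed auto
        also have "\<dots> = \<eta> * real n" by (simp add: algebra_simps)
        finally show ?thesis using elim(2) by (simp add: pos_divide_le_eq)
      qed
    qed
    then have "limsup (\<lambda>n. ereal (ln (real (?N' n)) / real n)) \<le> ereal \<eta>"
      by (rule Limsup_bounded)
    then show "limsup (\<lambda>n. ereal (ln (real (?N' n)) / real n)) \<le> 0 + ereal \<eta>" by simp
  qed
qed

text \<open>Along each sequence the entropy on measures is either infinite or at most 0. Its
  supremum over sequences therefore cannot become infinite through a growing family of finite
  values, and the second equivalence follows from the dichotomy for single sequences.\<close>

theorem theorem5p5:
  fixes X :: "'a::metric_space set" and f :: "nat \<Rightarrow> 'a \<Rightarrow> 'a" and a :: "nat \<Rightarrow> nat"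
  assumes "compact X"
    and "\<And>n. continuous_on X (f n)"
    and "\<And>n. f n ` X \<subseteq> X"
    and "strict_mono a"
  shows "(seq_entropy (top_of_set X) f a > 0 \<longleftrightarrow>
           seq_entropy (weak_star_topology X) (\<lambda>n. push_forward X (f n)) a = \<infinity>)
       \<and> (seq_entropy_star (top_of_set X) f > 0 \<longleftrightarrow>
           seq_entropy_star (weak_star_topology X) (\<lambda>n. push_forward X (f n)) = \<infinity>)"
proof -
  let ?h = "seq_entropy (top_of_set X) f"
  let ?h' = "seq_entropy (weak_star_topology X) (\<lambda>n. push_forward X (f n))"
  have up: "?h' s = \<infinity>" if "0 < ?h s" for s
    using seq_entropy_push_forward_infinite[OF assms(1-3) that] .
  have down: "?h' s \<le> 0" if "\<not> 0 < ?h s" for s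
    using seq_entropy_push_forward_nonpos[OF assms(1-3)] that by (simp add: not_less)
  have "0 < ?h a \<longleftrightarrow> ?h' a = \<infinity>"
  proof (cases "0 < ?h a")
    case False
    from down[OF this] have "?h' a \<noteq> \<infinity>" by auto
    with False show ?thesis by simp
  qed (simp add: up)
  moreover have "seq_entropy_star (weak_star_topology X) (\<lambda>n. push_forward X (f n)) = \<infinity>"
    if pos: "0 < seq_entropy_star (top_of_set X) f"
  proof -
    obtain s where s: "strict_mono s" "0 < ?h s"
      using pos unfolding seq_entropy_star_def less_SUP_iff by blast
    have "?h' s \<le> seq_entropy_star (weak_star_topology X) (\<lambda>n. push_forward X (f n))"
      unfolding seq_entropy_star_def using s(1) by (intro SUP_upper) simp
    then show ?thesis using up[OF s(2)] by simp
  qed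
  moreover have "seq_entropy_star (weak_star_topology X) (\<lambda>n. push_forward X (f n)) \<noteq> \<infinity>"
    if no: "\<not> 0 < seq_entropy_star (top_of_set X) f"
  proof -
    have "?h' s \<le> 0" if "strict_mono s" for s
    proof (rule down)
      have "?h s \<le> seq_entropy_star (top_of_set X) f"
        unfolding seq_entropy_star_def using that by (intro SUP_upper) simp
      with no show "\<not> 0 < ?h s" by (meson not_less order_trans)
    qed
    then have "seq_entropy_star (weak_star_topology X) (\<lambda>n. push_forward X (f n)) \<le> 0"
      unfolding seq_entropy_star_def by (intro SUP_least) simp
    then show ?thesis by auto
  qed
  ultimately show ?thesis by blast
qed

end
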